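(* Let $(n,2d)=(3,6)$ and $m=9$, or $(n,2d)=(4,4)$ and $m=8$. Let $f_1,\ldots,f_{n-1}\in H_{n,d}$ be real forms intersecting transversely in $m=d^{n-1}$ projective points $\gamma_1,\ldots,\gamma_m$, all of which are real. Then we can choose affine representatives $z_1,\ldots,z_m\in\mathbb{R}^n$ for the projective points $\gamma_1,\ldots,\gamma_m$ so that the image $Sq'=E(\Sigma_{n,2d})$ of the cone $\Sigma_{n,2d}$ under the evaluation map $E: H_{n,2d}\to\mathbb{R}^m$, $E(p)=(p(z_1),\ldots,p(z_m))$, is given by $$Sq'=\left\{(x_1,\ldots,x_m) \in \mathbb{R}^m_+ \;\Big|\; \sum_{i=1}^m\sqrt{x_i} \geq 2\sqrt{x_k} \ \text{ for all } k=1,\ldots,m \right\}.$$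
   Context: $H_{n,d}$ is the real vector space of real forms (homogeneous polynomials) of degree $d$ in $n$ variables. $\Sigma_{n,2d}=\{p\in H_{n,2d} : p=\sum_i q_i^2 \text{ (finite sum) for some } q_i\in H_{n,d}\}$. $\mathbb{R}^m_+$ is the nonnegative orthant of $\mathbb{R}^m$. Forms $f_1,\ldots,f_{n-1}\in H_{n,d}$ intersect transversely if their common zero set in $\mathbb{CP}^{n-1}$ is finite and at each common zero their gradients are linearly independent; it then consists of exactly $d^{n-1}$ distinct points. An affine representative of a projective point is a nonzero vector spanning the corresponding line. *)

theory Defs
  imports "HOL-Analysis.Analysis" "HOL-Library.Poly_Mapping"
begin

text \<open>A real polynomial in the variables \<open>x\<^sub>i\<close>, \<open>i :: 'n\<close>, is a finitely supported map from exponent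
  vectors to coefficients; its ring operations are those of the library theory of
  polynomial mappings.\<close>

type_synonym 'n rpoly = "('n \<Rightarrow>\<^sub>0 nat) \<Rightarrow>\<^sub>0 real"

text \<open>Evaluation is used at real points and at complex points (\<open>of_real\<close> is the identity
  on the reals).\<close>

definition eval_poly :: "'n::finite rpoly \<Rightarrow> ('a::real_field) ^ 'n \<Rightarrow> 'a" where
  "eval_poly p z =
     (\<Sum>m\<in>Poly_Mapping.keys p.
        of_real (Poly_Mapping.lookup p m) * (\<Prod>i\<in>UNIV. (z $ i) ^ Poly_Mapping.lookup m i))"

text \<open>The formal derivative with respect to \<open>x\<^sub>i\<close>. The truncated subtraction of exponents
  is harmless: if \<open>x\<^sub>i\<close> does not occur in the monomial, the coefficient is \<open>0\<close>.\<close>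

definition partial_deriv :: "'n \<Rightarrow> 'n rpoly \<Rightarrow> 'n rpoly" where
  "partial_deriv i p =
     (\<Sum>m\<in>Poly_Mapping.keys p.
        Poly_Mapping.single (m - Poly_Mapping.single i 1)
          (of_nat (Poly_Mapping.lookup m i) * Poly_Mapping.lookup p m))"

definition gradient :: "'n::finite rpoly \<Rightarrow> ('a::real_field) ^ 'n \<Rightarrow> 'a ^ 'n" where
  "gradient p z = (\<chi> i. eval_poly (partial_deriv i p) z)"

text \<open>\<open>forms d\<close> is \<open>H\<^sub>n\<^sub>,\<^sub>d\<close> with \<open>n = CARD('n)\<close>; it contains the zero polynomial.\<close>

definition forms :: "nat \<Rightarrow> 'n::finite rpoly set" where
  "forms d = {p. \<forall>m\<in>Poly_Mapping.keys p. (\<Sum>i\<in>UNIV. Poly_Mapping.lookup m i) = d}"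

text \<open>\<open>sos_forms d\<close> is the cone of sums of squares in degree \<open>2 * d\<close>
  (the argument is the degree of the \<open>q i\<close>).\<close>

definition sos_forms :: "nat \<Rightarrow> 'n::finite rpoly set" where
  "sos_forms d = {p \<in> forms (2 * d).
     \<exists>(k::nat) q. (\<forall>i<k. q i \<in> forms d) \<and> p = (\<Sum>i<k. (q i)\<^sup>2)}"

text \<open>Points of complex projective space are the complex lines through the origin; \<open>vec.span\<close>
  is the span over the complex scalars (whereas \<open>span\<close> would be over the reals).\<close>

definition affine_representative :: "complex ^ 'n::finite \<Rightarrow> (complex ^ 'n) set \<Rightarrow> bool" where
  "affine_representative z \<gamma> \<longleftrightarrow> z \<noteq> 0 \<and> \<gamma> = vec.span {z}"

definition projective_points :: "(complex ^ 'n::finite) set set" where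
  "projective_points = {\<gamma>. \<exists>z. affine_representative z \<gamma>}"

definition complexify :: "real ^ 'n::finite \<Rightarrow> complex ^ 'n" where
  "complexify x = (\<chi> i. complex_of_real (x $ i))"

definition real_point :: "(complex ^ 'n::finite) set \<Rightarrow> bool" where
  "real_point \<gamma> \<longleftrightarrow> (\<exists>x :: real ^ 'n. affine_representative (complexify x) \<gamma>)"

definition common_zeros :: "'i set \<Rightarrow> ('i \<Rightarrow> 'n::finite rpoly) \<Rightarrow> (complex ^ 'n) set set" where
  "common_zeros I f = {\<gamma> \<in> projective_points.
     \<forall>z. affine_representative z \<gamma> \<longrightarrow> (\<forall>i\<in>I. eval_poly (f i) z = 0)}"

text \<open>Linear independence (over the complex numbers) is that of the family of gradients indexed
  by \<open>I\<close>, hence the injectivity condition besides independence of the set of gradients.\<close>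

definition intersect_transversely :: "'i set \<Rightarrow> ('i \<Rightarrow> 'n::finite rpoly) \<Rightarrow> bool" where
  "intersect_transversely I f \<longleftrightarrow>
     finite (common_zeros I f) \<and>
     (\<forall>\<gamma>\<in>common_zeros I f. \<forall>z. affine_representative z \<gamma> \<longrightarrow>
        inj_on (\<lambda>i. gradient (f i) z) I \<and> vec.independent ((\<lambda>i. gradient (f i) z) ` I))"

definition eval_map :: "('m::finite \<Rightarrow> real ^ 'n::finite) \<Rightarrow> 'n rpoly \<Rightarrow> real ^ 'm" where
  "eval_map z p = (\<chi> j. eval_poly p (z j))"

end

theory Submission
  imports Defs
begin

text \<open>The values at the \<open>m\<close> points of a form of degree \<open>d\<close> satisfy exactly one linear relation
  \<open>\<Sum>j. u\<^sub>j q(z\<^sub>j) = 0\<close>, and no \<open>u\<^sub>j\<close> vanishes (Cayley--Bacharach). A relation exists because the \<open>f\<^sub>i\<close>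
  are linearly independent forms in a space of dimension 10. That any \<open>m - 1\<close> of the points impose
  independent conditions is shown with products of linear forms, as too many points on a line or
  on a conic would force the whole curve into the finite zero set.

  After rescaling the points and changing signs of coordinates, the values of forms of degree \<open>d\<close>
  fill the hyperplane \<open>\<Sum>j. y\<^sub>j = 0\<close>. So \<open>x\<close> lies in the image of the sums of squares iff there are
  vectors of lengths \<open>\<surd>x\<^sub>j\<close> in some Euclidean space with sum zero. By the triangle inequality the
  polygon inequalities are necessary, and they suffice to close a polygon already in the plane,
  so two squares are enough.\<close>

section \<open>Evaluation of polynomials and forms\<close>

abbreviation monomial_value :: "('n::finite \<Rightarrow>\<^sub>0 nat) \<Rightarrow> ('a::real_field) ^ 'n \<Rightarrow> 'a" where
  "monomial_value m z \<equiv> (\<Prod>i\<in>UNIV. (z $ i) ^ Poly_Mapping.lookup m i)"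

lemma eval_poly_superset:
  assumes "finite A" "Poly_Mapping.keys p \<subseteq> A"
  shows "eval_poly p z = (\<Sum>m\<in>A. of_real (Poly_Mapping.lookup p m) * monomial_value m z)"
  unfolding eval_poly_def using assms by (intro sum.mono_neutral_left) (auto simp: in_keys_iff)

lemma eval_poly_zero [simp]: "eval_poly 0 z = 0"
  by (simp add: eval_poly_def)

lemma eval_poly_add: "eval_poly (p + q) z = eval_poly p z + eval_poly q z"
proof -
  let ?A = "Poly_Mapping.keys p \<union> Poly_Mapping.keys q"
  have "finite ?A" "Poly_Mapping.keys (p + q) \<subseteq> ?A"
    using Poly_Mapping.keys_add[of p q] by auto
  thus ?thesis
    by (simp add: eval_poly_superset[of ?A] lookup_add algebra_simps sum.distrib)
qed

lemma eval_poly_sum: "eval_poly (\<Sum>i\<in>A. p i) z = (\<Sum>i\<in>A. eval_poly (p i) z)"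
  by (induction A rule: infinite_finite_induct) (auto simp: eval_poly_add)

lemma eval_poly_single: "eval_poly (Poly_Mapping.single m c) z = of_real c * monomial_value m z"
  by (subst eval_poly_superset[of "{m}"]) auto

lemma rpoly_eq_sum_single:
  "p = (\<Sum>m\<in>Poly_Mapping.keys p. Poly_Mapping.single m (Poly_Mapping.lookup p m))"
  by (rule poly_mapping_eqI)
    (auto simp: lookup_sum lookup_single when_def in_keys_iff sum.delta)

lemma eval_poly_mult: "eval_poly (p * q) z = eval_poly p z * eval_poly q z"
proof -
  have "p * q = (\<Sum>m\<in>Poly_Mapping.keys p. \<Sum>m'\<in>Poly_Mapping.keys q.
      Poly_Mapping.single (m + m') (Poly_Mapping.lookup p m * Poly_Mapping.lookup q m'))"
    by (subst rpoly_eq_sum_single[of p], subst rpoly_eq_sum_single[of q])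
      (simp add: sum_product Poly_Mapping.mult_single)
  hence "eval_poly (p * q) z = (\<Sum>m\<in>Poly_Mapping.keys p. \<Sum>m'\<in>Poly_Mapping.keys q.
      of_real (Poly_Mapping.lookup p m * Poly_Mapping.lookup q m') * monomial_value (m + m') z)"
    by (simp add: eval_poly_sum eval_poly_single)
  also have "\<dots> = eval_poly p z * eval_poly q z"
    by (simp add: eval_poly_def sum_product lookup_add power_add prod.distrib algebra_simps)
  finally show ?thesis .
qed

lemma eval_poly_power2: "eval_poly (p\<^sup>2) z = (eval_poly p z)\<^sup>2"
  by (simp add: power2_eq_square eval_poly_mult)

text \<open>Scalars act as constant polynomials, so the rules for products of polynomials and of
  forms also cover scaling.\<close>

abbreviation scale_poly :: "real \<Rightarrow> 'n rpoly \<Rightarrow> 'n rpoly" where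
  "scale_poly c p \<equiv> Poly_Mapping.single 0 c * p"

lemma eval_poly_scale: "eval_poly (scale_poly c p) z = of_real c * eval_poly p z"
  by (simp add: eval_poly_mult eval_poly_single)

lemma lookup_scale_poly:
  "Poly_Mapping.lookup (scale_poly c p) m = c * Poly_Mapping.lookup p m"
proof -
  have "scale_poly c p = (\<Sum>m\<in>Poly_Mapping.keys p.
      Poly_Mapping.single m (c * Poly_Mapping.lookup p m))"
    by (subst rpoly_eq_sum_single[of p]) (simp add: sum_distrib_left Poly_Mapping.mult_single)
  thus ?thesis
    by (auto simp: lookup_sum lookup_single when_def in_keys_iff sum.delta)
qed

lemma eval_poly_of_real:
  "eval_poly p (complexify x) = complex_of_real (eval_poly p x)"
  by (simp add: eval_poly_def complexify_def)

lemma zero_in_forms [simp]: "0 \<in> forms d"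
  by (simp add: forms_def)

lemma forms_add: "p \<in> forms d \<Longrightarrow> q \<in> forms d \<Longrightarrow> p + q \<in> forms d"
  using Poly_Mapping.keys_add[of p q] by (auto simp: forms_def)

lemma forms_sum: "(\<And>i. i \<in> A \<Longrightarrow> p i \<in> forms d) \<Longrightarrow> (\<Sum>i\<in>A. p i) \<in> forms d"
  by (induction A rule: infinite_finite_induct) (auto simp: forms_add)

lemma forms_mult: "p \<in> forms d \<Longrightarrow> q \<in> forms e \<Longrightarrow> p * q \<in> forms (d + e)"
  using Poly_Mapping.keys_mult[of p q]
  by (fastforce simp: forms_def lookup_add sum.distrib)

lemma forms_scale: "p \<in> forms d \<Longrightarrow> scale_poly c p \<in> forms d"
  using forms_mult[of "Poly_Mapping.single 0 c" 0 p d] by (auto simp: forms_def)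

lemma eval_poly_homogeneous:
  assumes "p \<in> forms d"
  shows "eval_poly p (c *s z) = c ^ d * eval_poly p z"
proof -
  have "monomial_value m (c *s z) = c ^ d * monomial_value m z" if "m \<in> Poly_Mapping.keys p" for m
    using that assms
    by (simp add: forms_def power_mult_distrib prod.distrib power_sum[symmetric])
  thus ?thesis
    by (simp add: eval_poly_def sum_distrib_left mult.left_commute)
qed

definition linear_poly :: "real ^ 'n::finite \<Rightarrow> 'n rpoly" where
  "linear_poly a = (\<Sum>i\<in>UNIV. Poly_Mapping.single (Poly_Mapping.single i 1) (a $ i))"

lemma linear_poly_in_forms: "linear_poly a \<in> forms 1"
  unfolding linear_poly_def
  by (rule forms_sum) (auto simp: forms_def lookup_single when_def sum.delta split: if_splits)

lemma eval_linear_poly: "eval_poly (linear_poly a) (x :: real ^ 'n::finite) = a \<bullet> x"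
proof -
  have "monomial_value (Poly_Mapping.single i 1) x = x $ i" for i
  proof -
    have "(\<Prod>j\<in>UNIV. x $ j ^ (if i = j then Suc 0 else 0)) = (\<Prod>j\<in>UNIV. if i = j then x $ j else 1)"
      by (rule prod.cong) auto
    thus ?thesis by (simp add: lookup_single when_def prod.delta)
  qed
  thus ?thesis
    by (simp add: linear_poly_def eval_poly_sum eval_poly_single inner_vec_def)
qed

section \<open>Formal derivatives and gradients\<close>

lemma partial_deriv_superset:
  assumes "finite A" "Poly_Mapping.keys p \<subseteq> A"
  shows "partial_deriv i p = (\<Sum>m\<in>A. Poly_Mapping.single (m - Poly_Mapping.single i 1)
          (of_nat (Poly_Mapping.lookup m i) * Poly_Mapping.lookup p m))"
  unfolding partial_deriv_def using assms
  by (intro sum.mono_neutral_left) (auto simp: in_keys_iff)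

lemma partial_deriv_add: "partial_deriv i (p + q) = partial_deriv i p + partial_deriv i q"
proof -
  let ?A = "Poly_Mapping.keys p \<union> Poly_Mapping.keys q"
  have "finite ?A" "Poly_Mapping.keys (p + q) \<subseteq> ?A"
    using Poly_Mapping.keys_add[of p q] by auto
  thus ?thesis
    by (simp add: partial_deriv_superset[of ?A] lookup_add single_add distrib_left sum.distrib)
qed

lemma partial_deriv_scale: "partial_deriv i (scale_poly c p) = scale_poly c (partial_deriv i p)"
proof -
  have "Poly_Mapping.keys (scale_poly c p) \<subseteq> Poly_Mapping.keys p"
    by (auto simp: in_keys_iff lookup_scale_poly)
  thus ?thesis
    by (simp add: partial_deriv_superset[of "Poly_Mapping.keys p"] lookup_scale_poly
        sum_distrib_left Poly_Mapping.mult_single mult.left_commute)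
qed

lemma gradient_zero [simp]: "gradient 0 z = 0"
  by (simp add: gradient_def partial_deriv_def vec_eq_iff)

lemma gradient_add: "gradient (p + q) z = gradient p z + gradient q z"
  by (simp add: gradient_def partial_deriv_add eval_poly_add vec_eq_iff)

lemma gradient_scale: "gradient (scale_poly c p) z = of_real c *s gradient p z"
  by (simp add: gradient_def partial_deriv_scale eval_poly_scale vec_eq_iff)

lemma gradient_sum: "gradient (\<Sum>i\<in>A. p i) z = (\<Sum>i\<in>A. gradient (p i) z)"
  by (induction A rule: infinite_finite_induct) (auto simp: gradient_add)

section \<open>Sums of squares on a hyperplane\<close>

text \<open>The points \<open>0\<close>, \<open>s\<close> and \<open>a\<close> are the corners of a
  triangle with sides \<open>s\<close>, \<open>t\<close> and \<open>r\<close>, possibly degenerate.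
  The hypotheses are its triangle inequalities.\<close>

lemma ex_complex_triangle:
  fixes s r t :: real
  assumes "0 \<le> s" "0 \<le> r" "\<bar>s - r\<bar> \<le> t" "t \<le> s + r"
  shows "\<exists>a::complex. cmod a = t \<and> cmod (of_real s - a) = r"
proof (cases "s = 0")
  case True
  thus ?thesis using assms by (intro exI[of _ "of_real t"]) auto
next
  case False
  \<comment> \<open>By the law of cosines this is the real part of the apex
    \<open>a\<close>.\<close>
  define x where "x = (t\<^sup>2 + s\<^sup>2 - r\<^sup>2) / (2 * s)"
  have s: "s > 0" using False assms by simp
  have t: "t \<ge> 0" using assms by linarith
  have "(s - t)\<^sup>2 \<le> r\<^sup>2" "r\<^sup>2 \<le> (s + t)\<^sup>2"
    using assms t by (auto simp flip: abs_le_square_iff)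
  hence "2 * s * x \<le> 2 * s * t" and "2 * s * (- t) \<le> 2 * s * x"
    using s by (auto simp: x_def power2_sum power2_diff)
  hence "x \<le> t" and "- t \<le> x"
    using s mult_left_le_imp_le[of "2 * s" x t] mult_left_le_imp_le[of "2 * s" "- t" x] by fastforce+
  hence "\<bar>x\<bar> \<le> t" by simp
  hence x: "x\<^sup>2 \<le> t\<^sup>2" by (metis abs_le_square_iff abs_of_nonneg t)
  have "(s - x)\<^sup>2 + (t\<^sup>2 - x\<^sup>2) = r\<^sup>2"
    using s by (simp add: x_def power2_eq_square field_simps)
  thus ?thesis using x t assms
    by (intro exI[of _ "Complex x (sqrt (t\<^sup>2 - x\<^sup>2))"]) (simp add: cmod_def)
qed

text \<open>A polygonal path with sides \<open>r j\<close> is joined to a last side of length \<open>s\<close>; in the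
  induction step the first side is cut off along a diagonal, taken as long as possible.\<close>

lemma closing_polygon:
  fixes r :: "'j \<Rightarrow> real"
  assumes "finite J" "\<And>j. j \<in> J \<Longrightarrow> 0 \<le> r j" "0 \<le> s" "s \<le> sum r J"
    and "\<And>k. k \<in> J \<Longrightarrow> 2 * r k \<le> sum r J + s"
  shows "\<exists>w::'j \<Rightarrow> complex. (\<forall>j\<in>J. cmod (w j) = r j) \<and> sum w J = of_real s"
  using assms
proof (induction J arbitrary: s rule: finite_induct)
  case empty
  thus ?case by simp
next
  case (insert k J)
  define t where "t = min (s + r k) (sum r J)"
  have rk: "0 \<le> r k" and rJ: "\<And>j. j \<in> J \<Longrightarrow> 0 \<le> r j" using insert.prems by auto
  have nonneg: "0 \<le> sum r J" using rJ by (rule sum_nonneg)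
  have le: "r j \<le> sum r J" if "j \<in> J" for j
    using that rJ insert.hyps by (intro member_le_sum) auto
  have s: "s \<le> r k + sum r J" "r k \<le> sum r J + s"
    using insert.prems(3) insert.prems(4)[of k] insert.hyps by auto
  have "2 * r j \<le> sum r J + t" if "j \<in> J" for j
    using insert.prems(4)[of j] that le[OF that] insert.hyps by (auto simp: t_def)
  then obtain w where w: "\<forall>j\<in>J. cmod (w j) = r j" "sum w J = of_real t"
    using insert.IH[of t] rJ rk nonneg insert.prems(2) by (auto simp: t_def)
  have "\<bar>s - r k\<bar> \<le> t" "t \<le> s + r k"
    using s rk insert.prems(2) by (auto simp: t_def)
  then obtain a :: complex where a: "cmod a = t" "cmod (of_real s - a) = r k"
    using ex_complex_triangle insert.prems(2) rk by blast
  \<comment> \<open>The path from the induction hypothesis ends at \<open>t\<close> on the real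
    axis; multiplication by the unit \<open>e\<close> turns it so that it ends at
    \<open>a\<close>.\<close>
  obtain e :: complex where e: "cmod e = 1" "e * of_real t = a"
  proof (cases "t = 0")
    case False
    thus ?thesis using a by (intro that[of "a / of_real t"]) (auto simp: norm_divide)
  qed (use a in \<open>auto intro: that[of 1]\<close>)
  define w' where "w' = (\<lambda>j. if j = k then of_real s - a else e * w j)"
  have "sum w' J = e * sum w J"
    unfolding sum_distrib_left using insert.hyps by (intro sum.cong) (auto simp: w'_def)
  hence "sum w' (insert k J) = of_real s"
    using insert.hyps w e by (simp add: w'_def)
  moreover have "\<forall>j\<in>insert k J. cmod (w' j) = r j"
    using w a e by (auto simp: w'_def norm_mult)
  ultimately show ?case by blast
qed

lemma L2_set_sum_le:
  assumes "finite J"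
  shows "L2_set (\<lambda>i. \<Sum>j\<in>J. g j i) A \<le> (\<Sum>j\<in>J. L2_set (g j) A)"
  using assms
proof (induction J rule: finite_induct)
  case empty
  thus ?case by (simp add: L2_set_def)
next
  case (insert k J)
  thus ?case using L2_set_triangle_ineq[of "g k" "\<lambda>i. \<Sum>j\<in>J. g j i" A] by simp
qed

text \<open>For each \<open>j\<close> the numbers \<open>\<epsilon> j * y i $ j\<close> with
  \<open>i < k\<close> form a vector, and these vectors sum to zero. Hence each is minus the sum of
  the others, and the triangle inequality bounds its length by theirs.\<close>

lemma sqrt_sum_squares_hyperplane:
  fixes y :: "nat \<Rightarrow> real ^ 'm::finite" and \<epsilon> :: "'m \<Rightarrow> real"
  assumes "\<And>j. \<bar>\<epsilon> j\<bar> = 1" and "\<And>i. i < k \<Longrightarrow> (\<Sum>j\<in>UNIV. \<epsilon> j * y i $ j) = 0"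
  shows "2 * sqrt (\<Sum>i<k. (y i $ l)\<^sup>2) \<le> (\<Sum>j\<in>UNIV. sqrt (\<Sum>i<k. (y i $ j)\<^sup>2))"
proof -
  define n where "n j = L2_set (\<lambda>i. y i $ j) {..<k}" for j
  have sq: "\<epsilon> j * \<epsilon> j = 1" for j
    using assms(1)[of j] by (metis abs_mult_self_eq mult_1)
  have flip: "L2_set (\<lambda>i. \<epsilon> j * y i $ j) {..<k} = n j" for j
    using sq[of j] by (simp add: n_def L2_set_def power_mult_distrib power2_eq_square[of "\<epsilon> j"])
  have eq: "\<epsilon> l * y i $ l = - (\<Sum>j\<in>UNIV - {l}. \<epsilon> j * y i $ j)" if "i < k" for i
    using assms(2)[OF that] by (simp add: sum.remove[of UNIV l] add_eq_0_iff)
  have "n l = L2_set (\<lambda>i. \<Sum>j\<in>UNIV - {l}. \<epsilon> j * y i $ j) {..<k}"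
    unfolding flip[symmetric] L2_set_def using eq by simp
  also have "\<dots> \<le> (\<Sum>j\<in>UNIV - {l}. L2_set (\<lambda>i. \<epsilon> j * y i $ j) {..<k})"
    by (rule L2_set_sum_le) simp
  finally have "2 * n l \<le> (\<Sum>j\<in>UNIV. n j)"
    by (simp add: flip sum.remove[of UNIV l])
  thus ?thesis by (simp add: n_def L2_set_def)
qed

text \<open>The numbers \<open>sqrt (x $ j)\<close> are the side lengths of a closed polygon in the
  complex plane. The real and imaginary parts of its sides, up to the signs
  \<open>\<epsilon> j\<close>, are \<open>a\<close> and \<open>b\<close>.\<close>

lemma ex_two_squares_hyperplane:
  fixes x :: "real ^ 'm::finite" and \<epsilon> :: "'m \<Rightarrow> real"
  assumes "\<And>j. \<bar>\<epsilon> j\<bar> = 1" and "\<And>j. 0 \<le> x $ j"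
    and "\<And>k. 2 * sqrt (x $ k) \<le> (\<Sum>j\<in>UNIV. sqrt (x $ j))"
  shows "\<exists>a b. (\<Sum>j\<in>UNIV. \<epsilon> j * a $ j) = 0 \<and> (\<Sum>j\<in>UNIV. \<epsilon> j * b $ j) = 0 \<and>
           (\<forall>j. x $ j = (a $ j)\<^sup>2 + (b $ j)\<^sup>2)"
proof -
  \<comment> \<open>A last side of length 0 means that the path with the given sides closes by
    itself.\<close>
  obtain w :: "'m \<Rightarrow> complex" where w: "\<And>j. cmod (w j) = sqrt (x $ j)" "sum w UNIV = 0"
    using closing_polygon[of UNIV "\<lambda>j. sqrt (x $ j)" 0] assms sum_nonneg[of UNIV "\<lambda>j. sqrt (x $ j)"]
    by auto
  have sq: "\<epsilon> j * \<epsilon> j = 1" for j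
    using assms(1)[of j] by (metis abs_mult_self_eq mult_1)
  have sq2: "(\<epsilon> j * c)\<^sup>2 = c\<^sup>2" for j c
    using sq[of j] by (simp add: power_mult_distrib power2_eq_square)
  have sq1: "\<epsilon> j * (\<epsilon> j * c) = c" for j c
    using sq[of j] by (simp add: mult.assoc[symmetric])
  define a b :: "real ^ 'm" where "a = (\<chi> j. \<epsilon> j * Re (w j))" and "b = (\<chi> j. \<epsilon> j * Im (w j))"
  have "x $ j = (a $ j)\<^sup>2 + (b $ j)\<^sup>2" for j
  proof -
    have "x $ j = (cmod (w j))\<^sup>2" using w assms(2) by simp
    thus ?thesis by (simp add: a_def b_def sq2 cmod_power2)
  qed
  moreover have "(\<Sum>j\<in>UNIV. \<epsilon> j * a $ j) = 0" "(\<Sum>j\<in>UNIV. \<epsilon> j * b $ j) = 0"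
    using w(2) by (simp_all add: a_def b_def sq1 flip: Re_sum Im_sum)
  ultimately show ?thesis by blast
qed

text \<open>The orthogonal complement of \<open>W\<close> contains \<open>u\<close>, and by
  \<open>indep\<close> a vector in it is determined by any one of its coordinates. So the complement
  is the line through \<open>u\<close>.\<close>

lemma subspace_eq_hyperplane:
  fixes W :: "(real ^ 'm::finite) set"
  assumes "subspace W" and u: "\<And>k. u $ k \<noteq> 0" "\<And>y. y \<in> W \<Longrightarrow> u \<bullet> y = 0"
    and indep: "\<And>v k. (\<And>y. y \<in> W \<Longrightarrow> v \<bullet> y = 0) \<Longrightarrow> v $ k = 0 \<Longrightarrow> v = 0"
  shows "W = {y. u \<bullet> y = 0}"
proof (intro equalityI subsetI)
  fix y assume y: "y \<in> {y. u \<bullet> y = 0}"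
  obtain w z where wz: "w \<in> span W" "\<And>v. v \<in> span W \<Longrightarrow> orthogonal z v" "y = w + z"
    using orthogonal_subspace_decomp_exists[of W y] by metis
  have w: "w \<in> W" using wz(1) assms(1) span_eq_iff by blast
  define k :: 'm where "k = undefined"
  \<comment> \<open>The multiple of \<open>u\<close> is chosen to cancel coordinate
    \<open>k\<close>, an arbitrary index.\<close>
  have "z - (z $ k / u $ k) *\<^sub>R u = 0"
  proof (rule indep[of _ k])
    fix v assume "v \<in> W"
    thus "(z - (z $ k / u $ k) *\<^sub>R u) \<bullet> v = 0"
      using wz(2)[of v] u(2)[of v] by (simp add: inner_diff_left orthogonal_def span_base)
  qed (use u in simp)
  then obtain c where c: "z = c *\<^sub>R u" by auto
  have "u \<bullet> z = 0" using y w u(2) wz(3) by (simp add: inner_add_right)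
  hence "z = 0" using c by auto
  thus "y \<in> W" using w wz(3) by simp
qed (use u in auto)

section \<open>Forms restricted to rational curves\<close>

text \<open>\<open>p\<close> is the dehomogenization of \<open>g\<close>; the point at infinity \<open>s = 0\<close> is treated separately
  because of \<open>t / 0 = 0\<close>.\<close>

definition binary_form :: "nat \<Rightarrow> (real \<Rightarrow> real \<Rightarrow> real) \<Rightarrow> bool" where
  "binary_form e g \<longleftrightarrow> (\<exists>p. degree p \<le> e \<and>
     (\<forall>s t. g s t = (if s = 0 then coeff p e * t ^ e else s ^ e * poly p (t / s))))"

lemma binary_form_const: "binary_form 0 (\<lambda>s t. c)"
  unfolding binary_form_def by (intro exI[of _ "[:c:]"]) simp

lemma binary_form_linear: "binary_form 1 (\<lambda>s t. a * s + b * t)"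
  unfolding binary_form_def by (intro exI[of _ "[:a, b:]"]) (simp add: field_simps)

lemma binary_form_add:
  assumes "binary_form e g" "binary_form e h"
  shows "binary_form e (\<lambda>s t. g s t + h s t)"
proof -
  obtain p q where "degree p \<le> e" "degree q \<le> e"
    "\<And>s t. g s t = (if s = 0 then coeff p e * t ^ e else s ^ e * poly p (t / s))"
    "\<And>s t. h s t = (if s = 0 then coeff q e * t ^ e else s ^ e * poly q (t / s))"
    using assms unfolding binary_form_def by blast
  thus ?thesis unfolding binary_form_def
    by (intro exI[of _ "p + q"]) (auto simp: degree_add_le algebra_simps)
qed

lemma binary_form_mult:
  assumes "binary_form e g" "binary_form e' h"
  shows "binary_form (e + e') (\<lambda>s t. g s t * h s t)"
proof -
  obtain p q where p: "degree p \<le> e" and q: "degree q \<le> e'" and gh: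
    "\<And>s t. g s t = (if s = 0 then coeff p e * t ^ e else s ^ e * poly p (t / s))"
    "\<And>s t. h s t = (if s = 0 then coeff q e' * t ^ e' else s ^ e' * poly q (t / s))"
    using assms unfolding binary_form_def by blast
  \<comment> \<open>These coefficients are the values at infinity, that is, at
    \<open>(0, 1)\<close>. By the degree bounds only \<open>i = e\<close> contributes to that of the
    product.\<close>
  have "coeff (p * q) (e + e') = (\<Sum>i\<le>e + e'. if i = e then coeff p e * coeff q e' else 0)"
    unfolding coeff_mult
  proof (rule sum.cong)
    fix i
    have "coeff p i * coeff q (e + e' - i) = 0" if "i \<noteq> e"
      using p q that by (cases "i < e") (auto simp: coeff_eq_0)
    thus "coeff p i * coeff q (e + e' - i) = (if i = e then coeff p e * coeff q e' else 0)" by simp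
  qed simp
  hence "coeff (p * q) (e + e') = coeff p e * coeff q e'" by (simp add: sum.delta)
  moreover have "degree (p * q) \<le> e + e'"
    using degree_mult_le[of p q] p q by linarith
  ultimately show ?thesis unfolding binary_form_def
    by (intro exI[of _ "p * q"]) (auto simp: gh power_add algebra_simps)
qed

lemma binary_form_sum:
  assumes "\<And>i. i \<in> A \<Longrightarrow> binary_form e (g i)"
  shows "binary_form e (\<lambda>s t. \<Sum>i\<in>A. g i s t)"
proof -
  have zero: "binary_form e (\<lambda>s t. 0)"
    unfolding binary_form_def by (intro exI[of _ 0]) simp
  show ?thesis using assms
    by (induction A rule: infinite_finite_induct) (auto simp: zero intro!: binary_form_add)
qed

lemma binary_form_power:
  assumes "binary_form e g"
  shows "binary_form (e * m) (\<lambda>s t. g s t ^ m)"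
proof (induction m)
  case (Suc m)
  thus ?case using binary_form_mult[OF assms Suc] by simp
qed (simp add: binary_form_const)

lemma binary_form_prod:
  assumes "finite A" "\<And>i. i \<in> A \<Longrightarrow> binary_form (e i) (g i)"
  shows "binary_form (\<Sum>i\<in>A. e i) (\<lambda>s t. \<Prod>i\<in>A. g i s t)"
  using assms
  by (induction A rule: finite_induct) (auto simp: binary_form_const intro!: binary_form_mult)

lemma binary_form_cmult: "binary_form e g \<Longrightarrow> binary_form e (\<lambda>s t. c * g s t)"
  using binary_form_mult[OF binary_form_const] by fastforce

lemma binary_form_homogeneous:
  assumes "binary_form e g"
  shows "g (l * s) (l * t) = l ^ e * g s t"
proof -
  obtain p where p: "degree p \<le> e"
    "\<And>s t. g s t = (if s = 0 then coeff p e * t ^ e else s ^ e * poly p (t / s))"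
    using assms unfolding binary_form_def by blast
  show ?thesis
  \<comment> \<open>Here \<open>l ^ e\<close> is \<open>0 ^ 0 = 1\<close>, so \<open>g\<close> has
    to be constant.\<close>
  proof (cases "l = 0 \<and> e = 0")
    case True
    then obtain c where "p = [:c:]" using p(1) by (auto elim: degree_eq_zeroE)
    thus ?thesis using True p by simp
  qed (auto simp: p power_mult_distrib)
qed

text \<open>A nonzero binary form of degree \<open>e\<close> has at most \<open>e\<close> zeros on
  the projective line: the finite ones are roots of \<open>p\<close>, and a zero at infinity lowers
  the degree of \<open>p\<close> below \<open>e\<close>.\<close>

lemma binary_form_eq_0:
  assumes g: "binary_form e g" and S: "finite S" "card S > e"
    and zero: "\<And>x. x \<in> S \<Longrightarrow> g (fst x) (snd x) = 0"
    and distinct: "\<And>x y. x \<in> S \<Longrightarrow> y \<in> S \<Longrightarrow> x \<noteq> y \<Longrightarrow> fst x * snd y \<noteq> snd x * fst y"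
  shows "g s t = 0"
proof -
  obtain p where p: "degree p \<le> e"
    "\<And>s t. g s t = (if s = 0 then coeff p e * t ^ e else s ^ e * poly p (t / s))"
    using g unfolding binary_form_def by blast
  define S1 where "S1 = {x \<in> S. fst x \<noteq> 0}"
  have "inj_on (\<lambda>x. snd x / fst x) S1"
    using distinct by (force simp: inj_on_def S1_def field_simps)
  hence card_eq: "card ((\<lambda>x. snd x / fst x) ` S1) = card S1" by (rule card_image)
  have "(\<lambda>x. snd x / fst x) ` S1 \<subseteq> {x. poly p x = 0}"
    using zero by (force simp: S1_def p(2))
  hence le: "card S1 \<le> card {x. poly p x = 0}" if "p \<noteq> 0"
    using card_eq card_mono[OF poly_roots_finite[OF that]] by metis
  have roots: "card {x. poly p x = 0} \<le> degree p" if "p \<noteq> 0"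
    using that by (rule card_poly_roots_bound)
  have "p = 0"
  proof (rule ccontr)
    assume "p \<noteq> 0"
    with le roots have S1: "card S1 \<le> degree p" by fastforce
    hence "S1 \<noteq> S" using S p(1) by auto
    then obtain x where x: "x \<in> S" "fst x = 0" by (auto simp: S1_def)
    \<comment> \<open>Two members of \<open>S\<close> with first coordinate 0 would be proportional,
      so at most one lies at infinity.\<close>
    have "S - {x} \<subseteq> S1"
      using distinct[of x] x by (force simp: S1_def)
    hence "card S - 1 \<le> card S1"
      using S x card_mono[of S1 "S - {x}"] by (auto simp: S1_def)
    hence deg: "degree p = e" using S1 p(1) S by linarith
    have "coeff p e * snd x ^ e = 0" using zero[OF x(1)] x p(2) by auto
    moreover have "coeff p e \<noteq> 0" using deg \<open>p \<noteq> 0\<close> by auto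
    \<comment> \<open>So \<open>x\<close> is \<open>(0, 0)\<close>, which is proportional to every
      other member of \<open>S\<close>.\<close>
    ultimately have "snd x = 0" "e > 0" by (auto simp: power_0_left split: if_splits)
    moreover have "S \<noteq> {x}" using S \<open>e > 0\<close> by auto
    then obtain y where "y \<in> S" "y \<noteq> x" using x by blast
    ultimately show False using distinct[OF x(1), of y] x by auto
  qed
  thus ?thesis using p by simp
qed

lemma binary_form_eval_poly:
  fixes \<phi> :: "real \<Rightarrow> real \<Rightarrow> real ^ 'n::finite"
  assumes f: "f \<in> forms d" and "\<And>i. binary_form k (\<lambda>s t. \<phi> s t $ i)"
  shows "binary_form (k * d) (\<lambda>s t. eval_poly f (\<phi> s t))"
  unfolding eval_poly_def of_real_eq_id id_apply
proof (intro binary_form_sum binary_form_cmult)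
  fix m assume "m \<in> Poly_Mapping.keys f"
  hence "(\<Sum>i\<in>UNIV. Poly_Mapping.lookup m i) = d" using f by (auto simp: forms_def)
  hence "k * d = (\<Sum>i\<in>UNIV. k * Poly_Mapping.lookup m i)" by (simp flip: sum_distrib_left)
  thus "binary_form (k * d) (\<lambda>s t. monomial_value m (\<phi> s t))"
    using binary_form_prod[of UNIV "\<lambda>i. k * Poly_Mapping.lookup m i"] assms(2)
    by (simp add: binary_form_power)
qed

text \<open>A case of Bezout's theorem: along a curve parametrized in degree \<open>k\<close>, the
  form \<open>f\<close> becomes a binary form of degree \<open>k * d\<close>, and distinct
  projective points have distinct projective parameters.\<close>

lemma form_vanishes_on_curve:
  fixes \<phi> :: "real \<Rightarrow> real \<Rightarrow> real ^ 'n::finite"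
  assumes f: "f \<in> forms d" and \<phi>: "\<And>i. binary_form k (\<lambda>s t. \<phi> s t $ i)"
    and R: "finite R" "card R > k * d" "0 \<notin> R"
    and indep: "\<And>x y. x \<in> R \<Longrightarrow> y \<in> R \<Longrightarrow> x \<noteq> y \<Longrightarrow> x \<notin> span {y}"
    and zero: "\<And>r. r \<in> R \<Longrightarrow> eval_poly f r = 0"
    and on_curve: "\<And>r. r \<in> R \<Longrightarrow> \<exists>s t c. r = c *\<^sub>R \<phi> s t"
  shows "eval_poly f (\<phi> s t) = 0"
proof -
  have hom: "\<phi> (l * s) (l * t) = l ^ k *\<^sub>R \<phi> s t" for l s t
    using binary_form_homogeneous[OF \<phi>] by (simp add: vec_eq_iff)
  obtain \<sigma> c where \<sigma>: "\<And>r. r \<in> R \<Longrightarrow> r = c r *\<^sub>R \<phi> (fst (\<sigma> r)) (snd (\<sigma> r))"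
  proof -
    have "\<forall>r\<in>R. \<exists>cs. r = fst cs *\<^sub>R \<phi> (fst (snd cs)) (snd (snd cs))"
      using on_curve by fastforce
    then obtain h where "\<forall>r\<in>R. r = fst (h r) *\<^sub>R \<phi> (fst (snd (h r))) (snd (snd (h r)))"
      by metis
    thus ?thesis by (intro that[of "\<lambda>r. fst (h r)" "\<lambda>r. snd (h r)"]) auto
  qed
  \<comment> \<open>Homogeneity of \<open>\<phi>\<close> turns proportional parameters into
    proportional points, which \<open>indep\<close> excludes.\<close>
  have multiple: False if r: "r \<in> R" "r' \<in> R" "r \<noteq> r'"
    and "fst (\<sigma> r) = l * fst (\<sigma> r')" "snd (\<sigma> r) = l * snd (\<sigma> r')" for r r' l
  proof -
    have "\<phi> (fst (\<sigma> r)) (snd (\<sigma> r)) = l ^ k *\<^sub>R \<phi> (fst (\<sigma> r')) (snd (\<sigma> r'))"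
      using that hom by simp
    moreover have "c r' \<noteq> 0" using R(3) r \<sigma>[of r'] by force
    ultimately have "r = (c r * l ^ k / c r') *\<^sub>R r'"
      using \<sigma>[OF r(1)] \<sigma>[OF r(2)] by (metis nonzero_divide_eq_eq scaleR_scaleR)
    thus False using indep[OF r] by (metis span_base span_mul singletonI)
  qed
  have distinct: "fst (\<sigma> r) * snd (\<sigma> r') \<noteq> snd (\<sigma> r) * fst (\<sigma> r')"
    if r: "r \<in> R" "r' \<in> R" "r \<noteq> r'" for r r'
  proof
    assume eq: "fst (\<sigma> r) * snd (\<sigma> r') = snd (\<sigma> r) * fst (\<sigma> r')"
    consider "fst (\<sigma> r') \<noteq> 0" | "snd (\<sigma> r') \<noteq> 0" | "fst (\<sigma> r') = 0" "snd (\<sigma> r') = 0" by blast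
    thus False
    proof cases
      case 1
      thus False using multiple[OF r, of "fst (\<sigma> r) / fst (\<sigma> r')"] eq by (simp add: field_simps)
    next
      case 2
      thus False using multiple[OF r, of "snd (\<sigma> r) / snd (\<sigma> r')"] eq by (simp add: field_simps)
    next
      case 3
      thus False using multiple[of r' r 0] r by simp
    qed
  qed
  show ?thesis
  proof (rule binary_form_eq_0[OF binary_form_eval_poly[OF f \<phi>], where S = "\<sigma> ` R"])
    have "inj_on \<sigma> R" using distinct by (metis inj_onI mult.commute)
    thus "card (\<sigma> ` R) > k * d" using R by (simp add: card_image)
  next
    fix x assume "x \<in> \<sigma> ` R"
    then obtain r where r: "r \<in> R" "x = \<sigma> r" by blast
    have "c r \<noteq> 0" using R(3) r \<sigma>[of r] by force
    moreover have "eval_poly f r = c r ^ d * eval_poly f (\<phi> (fst x) (snd x))"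
      using eval_poly_homogeneous[OF f] \<sigma>[OF r(1)] r(2) by (metis scalar_mult_eq_scaleR)
    ultimately show "eval_poly f (\<phi> (fst x) (snd x)) = 0" using zero[OF r(1)] by simp
  next
    fix x y assume "x \<in> \<sigma> ` R" "y \<in> \<sigma> ` R" "x \<noteq> y"
    thus "fst x * snd y \<noteq> snd x * fst y" using distinct by blast
  qed (use R in simp)
qed

section \<open>Real points among the complex zeros\<close>

text \<open>If two real vectors differ by a complex factor, its real part is a factor as
  well.\<close>

lemma complexify_span:
  assumes "vec.span {complexify x} = vec.span {complexify y}"
  shows "x \<in> span {y}"
proof -
  have "complexify x \<in> vec.span {complexify y}"
    using assms vec.span_base by blast
  then obtain k where k: "complexify x = k *s complexify y"
    using vec.span_breakdown_eq[of "complexify x" "complexify y" "{}"] by auto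
  have "x $ i = Re k * y $ i" for i
    using arg_cong[OF k, of "\<lambda>v. Re (v $ i)"] by (simp add: complexify_def)
  hence "x = Re k *\<^sub>R y" by (simp add: vec_eq_iff)
  thus ?thesis by (metis span_base span_mul singletonI)
qed

lemma complexify_eq_0_iff [simp]: "complexify x = 0 \<longleftrightarrow> x = 0"
  by (simp add: complexify_def vec_eq_iff)

text \<open>Homogeneity carries the vanishing from \<open>complexify x\<close> to all
  representatives of its projective point.\<close>

lemma real_common_zero:
  assumes "\<And>i. i \<in> I \<Longrightarrow> f i \<in> forms d" "x \<noteq> 0" "\<And>i. i \<in> I \<Longrightarrow> eval_poly (f i) x = 0"
  shows "vec.span {complexify x} \<in> common_zeros I f"
proof -
  have "eval_poly (f i) z = 0"
    if "i \<in> I" "affine_representative z (vec.span {complexify x})" for i z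
  proof -
    have "z \<in> vec.span {complexify x}"
      using that(2) vec.span_base unfolding affine_representative_def by blast
    then obtain k where "z = k *s complexify x"
      using vec.span_breakdown_eq[of z "complexify x" "{}"] by auto
    thus ?thesis
      using eval_poly_homogeneous[OF assms(1)[OF that(1)], of k "complexify x"] assms(3)[OF that(1)]
      by (simp add: eval_poly_of_real)
  qed
  thus ?thesis using assms(2)
    by (auto simp: common_zeros_def projective_points_def affine_representative_def
        intro!: exI[of _ "complexify x"])
qed

text \<open>Finitely many projective zeros cannot absorb infinitely many parameters injectively.
  Applied to a curve that meets each projective point for at most one parameter in \<open>T\<close>,
  this gives a contradiction.\<close>

lemma infinitely_many_real_zeros:
  fixes \<psi> :: "real \<Rightarrow> real ^ 'n::finite"
  assumes "finite (common_zeros I f)" "\<And>i. i \<in> I \<Longrightarrow> f i \<in> forms d"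
    and "infinite T" "\<And>t. t \<in> T \<Longrightarrow> \<psi> t \<noteq> 0"
    and "\<And>t i. t \<in> T \<Longrightarrow> i \<in> I \<Longrightarrow> eval_poly (f i) (\<psi> t) = 0"
  obtains t t' where "t \<in> T" "t' \<in> T" "t \<noteq> t'" "\<psi> t \<in> span {\<psi> t'}"
proof -
  have "(\<lambda>t. vec.span {complexify (\<psi> t)}) ` T \<subseteq> common_zeros I f"
    using assms real_common_zero by blast
  hence "finite ((\<lambda>t. vec.span {complexify (\<psi> t)}) ` T)"
    using assms(1) finite_subset by blast
  hence "\<not> inj_on (\<lambda>t. vec.span {complexify (\<psi> t)}) T"
    using assms(3) finite_imageD by blast
  then obtain t t' where "t \<in> T" "t' \<in> T" "t \<noteq> t'"
    "vec.span {complexify (\<psi> t)} = vec.span {complexify (\<psi> t')}"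
    unfolding inj_on_def by blast
  thus ?thesis using complexify_span by (intro that)
qed

section \<open>Points on lines and conics\<close>

lemma mem_span_2: "r \<in> span {p, q :: 'a::real_vector} \<longleftrightarrow> (\<exists>a b. r = a *\<^sub>R p + b *\<^sub>R q)"
proof -
  have "r \<in> span {p, q} \<longleftrightarrow> (\<exists>a b. r - a *\<^sub>R p = b *\<^sub>R q)"
    by (auto simp: span_breakdown_eq span_singleton)
  thus ?thesis by (simp add: diff_eq_eq add.commute)
qed

lemma mem_span_3:
  "r \<in> span {p, q, v :: 'a::real_vector} \<longleftrightarrow> (\<exists>a b c. r = a *\<^sub>R p + b *\<^sub>R q + c *\<^sub>R v)"
proof -
  have "r \<in> span {p, q, v} \<longleftrightarrow> (\<exists>a b c. r - a *\<^sub>R p = b *\<^sub>R q + c *\<^sub>R v)"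
    by (subst span_breakdown_eq) (auto simp: mem_span_2)
  thus ?thesis by (simp add: diff_eq_eq add_ac)
qed

lemma span_2_exchange:
  fixes x :: "'a::real_vector"
  assumes "x \<in> span {a, b}" "x \<notin> span {a}"
  shows "b \<in> span {a, x}"
  using in_span_insert[of x b "{a}"] assms by (simp add: insert_commute)

text \<open>The component of \<open>x\<close> orthogonal to the span, suitably scaled. It supplies
  linear forms that vanish at given points but not at another one.\<close>

lemma ex_separating_vector:
  fixes x :: "'a::euclidean_space"
  assumes "x \<notin> span S"
  obtains a where "\<And>y. y \<in> span S \<Longrightarrow> a \<bullet> y = 0" "a \<bullet> x = 1"
proof -
  obtain y z where yz: "y \<in> span S" "\<And>w. w \<in> span S \<Longrightarrow> orthogonal z w" "x = y + z"
    using orthogonal_subspace_decomp_exists[of S x] by metis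
  have "z \<noteq> 0" using assms yz by auto
  moreover have "z \<bullet> x = z \<bullet> z" using yz by (simp add: orthogonal_def inner_add_right)
  ultimately show ?thesis
    using yz(2) by (intro that[of "(1 / (z \<bullet> z)) *\<^sub>R z"]) (auto simp: orthogonal_def)
qed

text \<open>The setting once real representatives are chosen: \<open>pts_distinct\<close> says that
  the projective points are distinct, and finiteness refers to all complex zeros.\<close>

locale zero_configuration =
  fixes I :: "'i set" and f :: "'i \<Rightarrow> 'n::finite rpoly" and d :: nat and z :: "'m::finite \<Rightarrow> real ^ 'n"
  assumes finite_zeros: "finite (common_zeros I f)"
    and forms: "\<And>i. i \<in> I \<Longrightarrow> f i \<in> forms d"
    and zero: "\<And>i j. i \<in> I \<Longrightarrow> eval_poly (f i) (z j) = 0"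
    and pts_nonzero: "\<And>j. z j \<noteq> 0"
    and pts_distinct: "\<And>j k. j \<noteq> k \<Longrightarrow> z j \<notin> span {z k}"
begin

lemma inj_z: "inj z"
  using pts_distinct by (metis injI singletonI span_base)

lemma vanish_on_curve:
  fixes \<phi> :: "real \<Rightarrow> real \<Rightarrow> real ^ 'n"
  assumes "i \<in> I" "\<And>i. binary_form k (\<lambda>s t. \<phi> s t $ i)" "card J > k * d"
    and "\<And>j. j \<in> J \<Longrightarrow> \<exists>s t c. z j = c *\<^sub>R \<phi> s t"
  shows "eval_poly (f i) (\<phi> s t) = 0"
proof (rule form_vanishes_on_curve[OF forms[OF assms(1)] assms(2), where R = "z ` J"])
  show "card (z ` J) > k * d"
    using assms(3) inj_z by (metis card_image inj_on_subset subset_UNIV)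
next
  fix x y assume "x \<in> z ` J" "y \<in> z ` J" "x \<noteq> y"
  then obtain j l where "x = z j" "y = z l" "j \<noteq> l" by auto
  thus "x \<notin> span {y}" using pts_distinct[of j l] by simp
qed (use assms pts_nonzero zero in \<open>auto simp: finite_subset[OF subset_UNIV]\<close>)

text \<open>If more than \<open>d\<close> of the points lay on a line, each \<open>f i\<close> would
  vanish on the whole line, giving infinitely many common zeros.\<close>

lemma card_collinear_le:
  assumes "j \<noteq> k" "\<And>l. l \<in> J \<Longrightarrow> z l \<in> span {z j, z k}"
  shows "card J \<le> d"
proof (rule ccontr)
  assume J: "\<not> card J \<le> d"
  define \<phi> where "\<phi> = (\<lambda>s t. s *\<^sub>R z j + t *\<^sub>R z k)"
  have form: "binary_form 1 (\<lambda>s t. \<phi> s t $ i)" for i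
    using binary_form_linear[of "z j $ i" "z k $ i"] by (simp add: \<phi>_def mult.commute)
  have "\<exists>s t c. z l = c *\<^sub>R \<phi> s t" if l: "l \<in> J" for l
    using assms(2)[OF l] unfolding mem_span_2 \<phi>_def by (metis scaleR_one)
  hence vanish: "eval_poly (f i) (\<phi> s t) = 0" if "i \<in> I" for i s t
    using vanish_on_curve[OF that form, of J] J by simp
  have dep: "x = 0" if "x *\<^sub>R z j + y *\<^sub>R z k = 0" for x y
  proof (rule ccontr)
    assume "x \<noteq> 0"
    have "x *\<^sub>R z j = (- y) *\<^sub>R z k" using that by (simp add: add_eq_0_iff2)
    hence "z j = (1 / x) *\<^sub>R ((- y) *\<^sub>R z k)" using \<open>x \<noteq> 0\<close>
      by (metis divide_self_if scaleR_one scaleR_scaleR times_divide_eq_left mult_1)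
    thus False using pts_distinct[OF assms(1)] by (metis span_base span_mul singletonI)
  qed
  obtain t t' where t: "t \<noteq> t'" "\<phi> 1 t \<in> span {\<phi> 1 t'}"
  proof (rule infinitely_many_real_zeros[OF finite_zeros forms, of UNIV "\<phi> 1"])
    show "\<phi> 1 t \<noteq> 0" for t using dep[of 1 t] by (auto simp: \<phi>_def)
  qed (use vanish in \<open>auto simp: infinite_UNIV_char_0\<close>)
  then obtain c where "\<phi> 1 t = c *\<^sub>R \<phi> 1 t'" by (auto simp: span_singleton)
  hence eq: "(1 - c) *\<^sub>R z j + (t - c * t') *\<^sub>R z k = 0"
    by (simp add: \<phi>_def algebra_simps)
  \<comment> \<open>The coefficient of \<open>z j\<close> gives \<open>c = 1\<close>; then that of
    \<open>z k\<close> gives \<open>t = t'\<close>.\<close>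
  hence "c = 1" using dep by fastforce
  thus False using eq t(1) pts_nonzero by simp
qed

definition no_three_collinear :: "'m set \<Rightarrow> bool" where
  "no_three_collinear J \<longleftrightarrow> (\<forall>p\<in>J. \<forall>q\<in>J. \<forall>r\<in>J. p \<noteq> q \<and> p \<noteq> r \<and> q \<noteq> r \<longrightarrow> z r \<notin> span {z p, z q})"

lemma no_three_collinearD:
  "no_three_collinear J \<Longrightarrow> p \<in> J \<Longrightarrow> q \<in> J \<Longrightarrow> r \<in> J \<Longrightarrow> p \<noteq> q \<Longrightarrow> p \<noteq> r \<Longrightarrow> q \<noteq> r \<Longrightarrow>
    z r \<notin> span {z p, z q}"
  by (auto simp: no_three_collinear_def)

text \<open>A nonzero coefficient would allow its point to be expressed by the other two, hence to
  lie on their line.\<close>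

lemma three_points_independent:
  assumes "no_three_collinear J" "{p, q, r} \<subseteq> J" "p \<noteq> q" "p \<noteq> r" "q \<noteq> r"
    and eq: "a *\<^sub>R z p + b *\<^sub>R z q + c *\<^sub>R z r = 0"
  shows "a = 0 \<and> b = 0 \<and> c = 0"
proof -
  have gen: "v = 0" if "p' \<in> J" "q' \<in> J" "r' \<in> J" "p' \<noteq> q'" "p' \<noteq> r'" "q' \<noteq> r'"
    "v *\<^sub>R z r' + u *\<^sub>R z p' + w *\<^sub>R z q' = 0" for p' q' r' u v w
  proof (rule ccontr)
    assume "v \<noteq> 0"
    have "v *\<^sub>R z r' = (- u) *\<^sub>R z p' + (- w) *\<^sub>R z q'"
      using that(7) by (simp add: algebra_simps add_eq_0_iff)
    hence "z r' = (1 / v) *\<^sub>R ((- u) *\<^sub>R z p' + (- w) *\<^sub>R z q')"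
      using \<open>v \<noteq> 0\<close> by (metis divide_self_if scaleR_one scaleR_scaleR times_divide_eq_left mult_1)
    hence "z r' \<in> span {z p', z q'}"
      unfolding mem_span_2 by (metis scaleR_add_right scaleR_scaleR)
    thus False using no_three_collinearD[OF assms(1) that(1-6)] by simp
  qed
  show ?thesis
    using gen[of p q r c a b] gen[of p r q b a c] gen[of q r p a b c] assms by (auto simp: add_ac)
qed

lemma three_points_coeffs_unique:
  assumes "no_three_collinear J" "{p, q, r} \<subseteq> J" "p \<noteq> q" "p \<noteq> r" "q \<noteq> r"
    and "a *\<^sub>R z p + b *\<^sub>R z q + c *\<^sub>R z r = a' *\<^sub>R z p + b' *\<^sub>R z q + c' *\<^sub>R z r"
  shows "a = a'" "b = b'" "c = c'"
proof -
  have "(a - a') *\<^sub>R z p + (b - b') *\<^sub>R z q + (c - c') *\<^sub>R z r = 0"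
    using assms(6) by (simp add: algebra_simps)
  thus "a = a'" "b = b'" "c = c'" using three_points_independent[OF assms(1-5)] by fastforce+
qed

text \<open>The quadratic transformation of the plane based at three of the points maps the line through
  the images of two further points to the conic through these five points.\<close>

lemma card_conic_le:
  assumes no3: "no_three_collinear J"
    and J: "{p, q, r, u, v} \<subseteq> J" "distinct [p, q, r, u, v]"
    and coord: "\<And>j. j \<in> J - {p, q, r} \<Longrightarrow> z j = X j *\<^sub>R z p + Y j *\<^sub>R z q + W j *\<^sub>R z r"
    and conic: "\<And>j. j \<in> J - {p, q, r} \<Longrightarrow> \<exists>s t. 1 / X j = s / X u + t / X v \<and>
          1 / Y j = s / Y u + t / Y v \<and> 1 / W j = s / W u + t / W v"
  shows "card J \<le> 2 * d"
proof (rule ccontr)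
  assume card: "\<not> card J \<le> 2 * d"
  note ind = no_three_collinearD[OF no3]
  \<comment> \<open>A vanishing coordinate would put \<open>z j\<close> on a side of the triangle
    \<open>p q r\<close>.\<close>
  have nz: "X j \<noteq> 0 \<and> Y j \<noteq> 0 \<and> W j \<noteq> 0" if j: "j \<in> J - {p, q, r}" for j
  proof -
    have "z j \<notin> span {z q, z r}" "z j \<notin> span {z p, z r}" "z j \<notin> span {z p, z q}"
      using j J by (intro ind; auto)+
    thus ?thesis using coord[OF j] unfolding mem_span_2 by force
  qed
  have uv: "u \<in> J - {p, q, r}" "v \<in> J - {p, q, r}" using J by auto
  \<comment> \<open>If a minor vanishes, eliminating one coordinate between \<open>z u\<close> and
    \<open>z v\<close> eliminates a second one too. What remains is a dependence between
    \<open>z u\<close>, \<open>z v\<close> and one vertex.\<close>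
  have minor: "X u * Y v \<noteq> X v * Y u \<and> X u * W v \<noteq> X v * W u \<and> Y u * W v \<noteq> Y v * W u"
  proof (intro conjI notI)
    assume "X u * Y v = X v * Y u"
    hence "X u *\<^sub>R z v + (- X v) *\<^sub>R z u + (X v * W u - X u * W v) *\<^sub>R z r = 0"
      by (subst coord[OF uv(1)], subst coord[OF uv(2)]) (simp add: algebra_simps)
    from three_points_independent[OF no3 _ _ _ _ this] J nz[OF uv(1)] show False by auto
  next
    assume "X u * W v = X v * W u"
    hence "X u *\<^sub>R z v + (- X v) *\<^sub>R z u + (X v * Y u - X u * Y v) *\<^sub>R z q = 0"
      by (subst coord[OF uv(1)], subst coord[OF uv(2)]) (simp add: algebra_simps)
    from three_points_independent[OF no3 _ _ _ _ this] J nz[OF uv(1)] show False by auto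
  next
    assume "Y u * W v = Y v * W u"
    hence "Y u *\<^sub>R z v + (- Y v) *\<^sub>R z u + (Y v * X u - Y u * X v) *\<^sub>R z p = 0"
      by (subst coord[OF uv(1)], subst coord[OF uv(2)]) (simp add: algebra_simps)
    from three_points_independent[OF no3 _ _ _ _ this] J nz[OF uv(1)] show False by auto
  qed
  define x y w where "x = (\<lambda>s t. s / X u + t / X v)" and "y = (\<lambda>s t. s / Y u + t / Y v)"
    and "w = (\<lambda>s t. s / W u + t / W v)"
  \<comment> \<open>\<open>(x, y, w)\<close> runs along the line through the images of
    \<open>u\<close> and \<open>v\<close>. The coordinates of \<open>\<phi>\<close> are the
    reciprocals of \<open>x\<close>, \<open>y\<close>, \<open>w\<close> cleared of denominators, so
    they make sense also where the line meets a side of the triangle.\<close>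
  define \<phi> where "\<phi> = (\<lambda>s t. (y s t * w s t) *\<^sub>R z p + (x s t * w s t) *\<^sub>R z q + (x s t * y s t) *\<^sub>R z r)"
  have lin: "binary_form 1 x" "binary_form 1 y" "binary_form 1 w"
    using binary_form_linear[of "1 / X u" "1 / X v"] binary_form_linear[of "1 / Y u" "1 / Y v"]
      binary_form_linear[of "1 / W u" "1 / W v"] by (simp_all add: x_def y_def w_def)
  have form: "binary_form 2 (\<lambda>s t. \<phi> s t $ i)" for i
  proof -
    have "binary_form 2 (\<lambda>s t. z p $ i * (y s t * w s t) + z q $ i * (x s t * w s t) + z r $ i * (x s t * y s t))"
      using binary_form_mult[OF lin(2,3)] binary_form_mult[OF lin(1,3)] binary_form_mult[OF lin(1,2)]
      by (intro binary_form_add binary_form_cmult) (simp_all add: numeral_2_eq_2)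
    thus ?thesis by (simp add: \<phi>_def mult_ac)
  qed
  have on_curve: "\<exists>s t c. z j = c *\<^sub>R \<phi> s t" if j: "j \<in> J" for j
  proof -
    have nzuv: "X u \<noteq> 0" "Y u \<noteq> 0" "W u \<noteq> 0" "X v \<noteq> 0" "Y v \<noteq> 0" "W v \<noteq> 0"
      using nz uv by blast+
    consider "j = p" | "j = q" | "j = r" | "j \<in> J - {p, q, r}" using j by blast
    thus ?thesis
    proof cases
      case 1
      \<comment> \<open>At this parameter \<open>x\<close> vanishes, and \<open>\<phi>\<close> is a
        nonzero multiple of \<open>z p\<close>. The other vertices are reached in the same
        way.\<close>
      have "x (X u) (- X v) = 0" "y (X u) (- X v) \<noteq> 0" "w (X u) (- X v) \<noteq> 0"
        using nzuv minor by (auto simp: x_def y_def w_def field_simps)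
      hence "z j = (1 / (y (X u) (- X v) * w (X u) (- X v))) *\<^sub>R \<phi> (X u) (- X v)"
        using 1 by (simp add: \<phi>_def)
      thus ?thesis by blast
    next
      case 2
      have "y (Y u) (- Y v) = 0" "x (Y u) (- Y v) \<noteq> 0" "w (Y u) (- Y v) \<noteq> 0"
        using nzuv minor by (auto simp: x_def y_def w_def field_simps)
      hence "z j = (1 / (x (Y u) (- Y v) * w (Y u) (- Y v))) *\<^sub>R \<phi> (Y u) (- Y v)"
        using 2 by (simp add: \<phi>_def)
      thus ?thesis by blast
    next
      case 3
      have "w (W u) (- W v) = 0" "x (W u) (- W v) \<noteq> 0" "y (W u) (- W v) \<noteq> 0"
        using nzuv minor by (auto simp: x_def y_def w_def field_simps)
      hence "z j = (1 / (x (W u) (- W v) * y (W u) (- W v))) *\<^sub>R \<phi> (W u) (- W v)"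
        using 3 by (simp add: \<phi>_def)
      thus ?thesis by blast
    next
      case 4
      obtain s t where st: "1 / X j = x s t" "1 / Y j = y s t" "1 / W j = w s t"
        using conic[OF 4] by (auto simp: x_def y_def w_def)
      have "(X j * Y j * W j) *\<^sub>R \<phi> s t = X j *\<^sub>R z p + Y j *\<^sub>R z q + W j *\<^sub>R z r"
        using nz[OF 4] by (simp add: \<phi>_def flip: st) (simp add: scaleR_add_right)
      thus ?thesis using coord[OF 4] by metis
    qed
  qed
  have vanish: "eval_poly (f i) (\<phi> s t) = 0" if "i \<in> I" for i s t
    using vanish_on_curve[OF that form, of J] card on_curve by auto
  \<comment> \<open>Where \<open>P\<close> does not vanish, all three coordinates of
    \<open>\<phi> 1 t\<close> are nonzero, so the point is nonzero and factors can be
    cancelled.\<close>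
  define P where "P = [:1 / X u, 1 / X v:] * [:1 / Y u, 1 / Y v:] * [:1 / W u, 1 / W v:]"
  have P: "poly P t = x 1 t * y 1 t * w 1 t" for t
    by (simp only: P_def poly_mult x_def y_def w_def) simp
  have "P \<noteq> 0" using nz[OF uv(1)] by (auto simp: P_def)
  hence inf: "infinite {t. poly P t \<noteq> 0}"
    using poly_roots_finite[of P] infinite_UNIV_char_0[where 'a = real]
    by (metis (mono_tags) Collect_neg_eq finite_Collect_not)
  obtain t t' where t: "poly P t \<noteq> 0" "poly P t' \<noteq> 0" "t \<noteq> t'" "\<phi> 1 t \<in> span {\<phi> 1 t'}"
  proof (rule infinitely_many_real_zeros[OF finite_zeros forms inf, of "\<phi> 1"])
    show "\<phi> 1 t \<noteq> 0" if "t \<in> {t. poly P t \<noteq> 0}" for t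
      using that three_points_independent[OF no3, of p q r "y 1 t * w 1 t" "x 1 t * w 1 t" "x 1 t * y 1 t"] J
      by (auto simp: \<phi>_def P)
  qed (use vanish in auto)
  then obtain c where c: "\<phi> 1 t = c *\<^sub>R \<phi> 1 t'" by (auto simp: span_singleton)
  have "y 1 t * w 1 t = c * (y 1 t' * w 1 t')" "x 1 t * w 1 t = c * (x 1 t' * w 1 t')"
    using c J three_points_coeffs_unique[OF no3, of p q r "y 1 t * w 1 t" "x 1 t * w 1 t" "x 1 t * y 1 t"
        "c * (y 1 t' * w 1 t')" "c * (x 1 t' * w 1 t')" "c * (x 1 t' * y 1 t')"]
    by (auto simp: \<phi>_def scaleR_add_right)
  hence "(y 1 t * w 1 t) * (c * (x 1 t' * w 1 t')) = (x 1 t * w 1 t) * (c * (y 1 t' * w 1 t'))"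
    by simp
  moreover have "c \<noteq> 0" "w 1 t \<noteq> 0" "w 1 t' \<noteq> 0"
    using t \<open>y 1 t * w 1 t = c * (y 1 t' * w 1 t')\<close> by (auto simp: P)
  ultimately have "y 1 t * x 1 t' = x 1 t * y 1 t'" by simp
  \<comment> \<open>The quotient of \<open>x 1 t\<close> and \<open>y 1 t\<close> is a Moebius
    function of \<open>t\<close>; up to a nonzero factor its determinant is a minor that was shown
    to be nonzero.\<close>
  hence "(t - t') * (X u * Y v - X v * Y u) = 0"
    using nz[OF uv(1)] nz[OF uv(2)] by (simp add: x_def y_def field_simps)
  thus False using t(3) minor by simp
qed

end

section \<open>Relations between the values at the points\<close>

lemma card_4_elements:
  assumes "finite A" "card A = 4"
  obtains a b c e where "A = {a, b, c, e}" "distinct [a, b, c, e]"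
proof -
  obtain xs where "set xs = A" "distinct xs" "length xs = 4"
    using assms finite_distinct_list distinct_card by metis
  thus ?thesis using that by (fastforce simp: length_Suc_conv eval_nat_numeral)
qed

lemma card_6_elements:
  assumes "finite A" "card A = 6"
  obtains a b c e g h where "A = {a, b, c, e, g, h}" "distinct [a, b, c, e, g, h]"
proof -
  obtain xs where "set xs = A" "distinct xs" "length xs = 6"
    using assms finite_distinct_list distinct_card by metis
  thus ?thesis using that by (fastforce simp: length_Suc_conv eval_nat_numeral)
qed

context zero_configuration
begin

definition relation :: "('m \<Rightarrow> real) \<Rightarrow> bool" where
  "relation c \<longleftrightarrow> (\<forall>q\<in>forms d. (\<Sum>j\<in>UNIV. c j * eval_poly q (z j)) = 0)"

lemma relation_supported:
  assumes "relation c" "q \<in> forms d" "\<And>j. j \<notin> S \<Longrightarrow> c j * eval_poly q (z j) = 0"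
  shows "(\<Sum>j\<in>S. c j * eval_poly q (z j)) = 0"
proof -
  have "(\<Sum>j\<in>S. c j * eval_poly q (z j)) = (\<Sum>j\<in>UNIV. c j * eval_poly q (z j))"
    using assms(3) by (intro sum.mono_neutral_left) auto
  thus ?thesis using assms(1,2) by (simp add: relation_def)
qed

text \<open>Only the term at \<open>x\<close> survives. Such forms \<open>q\<close> are built below
  as products of linear forms.\<close>

lemma relation_isolate:
  assumes "relation c" "q \<in> forms d" "\<And>j. j \<noteq> x \<Longrightarrow> c j * eval_poly q (z j) = 0"
    and "eval_poly q (z x) \<noteq> 0"
  shows "c x = 0"
  using relation_supported[of c q "{x}"] assms by auto

section \<open>Relations in degree 2: eight points\<close>

lemma no_three_collinear_if_quadrics:
  assumes "d = 2"
  shows "no_three_collinear J"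
  unfolding no_three_collinear_def
proof (intro ballI impI notI)
  fix p q r assume "p \<noteq> q \<and> p \<noteq> r \<and> q \<noteq> r" "z r \<in> span {z p, z q}"
  moreover from this have "card {p, q, r} \<le> d"
    by (intro card_collinear_le[of p q]) (auto intro: span_base)
  ultimately show False using assms by simp
qed

text \<open>Five points of a plane lie on a conic, which carries at most \<open>2 * d = 4\<close> of
  the points. With only \<open>u\<close> and \<open>v\<close> besides the vertices, the conic
  condition of \<open>card_conic_le\<close> is trivial.\<close>

lemma no_five_coplanar:
  assumes d: "d = 2" and "distinct [p, q, r, u, v]"
    and mem: "z u \<in> span {z p, z q, z r}" "z v \<in> span {z p, z q, z r}"
  shows False
proof -
  have ex: "\<forall>j\<in>{u, v}. \<exists>a. z j = fst a *\<^sub>R z p + fst (snd a) *\<^sub>R z q + snd (snd a) *\<^sub>R z r"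
    using mem by (auto simp: mem_span_3)
  obtain a where a: "\<And>j. j \<in> {u, v} \<Longrightarrow> z j = fst (a j) *\<^sub>R z p + fst (snd (a j)) *\<^sub>R z q + snd (snd (a j)) *\<^sub>R z r"
    using bchoice[OF ex] by blast
  have "card {p, q, r, u, v} \<le> 2 * d"
  proof (rule card_conic_le[OF no_three_collinear_if_quadrics[OF d] order_refl assms(2)])
    fix j assume "j \<in> {p, q, r, u, v} - {p, q, r}"
    hence j: "j \<in> {u, v}" by auto
    show "z j = fst (a j) *\<^sub>R z p + fst (snd (a j)) *\<^sub>R z q + snd (snd (a j)) *\<^sub>R z r"
      using j by (rule a)
    show "\<exists>s t. 1 / fst (a j) = s / fst (a u) + t / fst (a v) \<and>
          1 / fst (snd (a j)) = s / fst (snd (a u)) + t / fst (snd (a v)) \<and>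
          1 / snd (snd (a j)) = s / snd (snd (a u)) + t / snd (snd (a v))"
    proof (cases "j = u")
      case True
      thus ?thesis by (intro exI[of _ 1] exI[of _ 0]) simp
    next
      case False
      thus ?thesis using j by (intro exI[of _ 0] exI[of _ 1]) simp
    qed
  qed
  thus False using assms by simp
qed

text \<open>Both planes would be the plane through \<open>p\<close>, \<open>q\<close> and
  \<open>x\<close>, which would then contain five points.\<close>

lemma plane_exchange:
  assumes d: "d = 2" and "distinct [p, q, u, v, x]"
    and "z x \<in> span {z p, z q, z u}" "z x \<in> span {z p, z q, z v}"
  shows False
proof -
  have "z x \<notin> span {z p, z q}"
    using no_three_collinearD[OF no_three_collinear_if_quadrics[OF d, of UNIV]] assms(2) by simp
  hence "z u \<in> span {z x, z p, z q}" "z v \<in> span {z x, z p, z q}"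
    using assms(3,4) in_span_insert[of "z x" _ "{z p, z q}"] by (simp_all add: insert_commute)
  thus False using no_five_coplanar[OF d, of x p q u v] assms(2) by auto
qed

text \<open>The six points other than \<open>k\<close> and \<open>x\<close> are split into two
  triples whose planes miss \<open>x\<close>; the product of the two plane equations isolates
  \<open>x\<close>.\<close>

lemma relation_eq_0_quadrics:
  assumes d: "d = 2" and card: "CARD('m) = 8" and c: "relation c" "c k = 0"
  shows "c x = 0"
proof (cases "x = k")
  case False
  have "card (UNIV - {k, x}) = 6" using card False by (simp add: card_Diff_subset)
  then obtain a1 a2 a3 a4 a5 a6 where a: "UNIV - {k, x} = {a1, a2, a3, a4, a5, a6}"
    "distinct [a1, a2, a3, a4, a5, a6]"
    by (metis card_6_elements finite)
  have x: "x \<notin> {a1, a2, a3, a4, a5, a6}" using a(1) by blast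
  have split: ?thesis
    if eq: "{p, q, r, p', q', r'} = {a1, a2, a3, a4, a5, a6}"
      and s1: "z x \<notin> span {z p, z q, z r}" and s2: "z x \<notin> span {z p', z q', z r'}" for p q r p' q' r'
  proof -
    obtain v where v: "\<And>y. y \<in> span {z p, z q, z r} \<Longrightarrow> v \<bullet> y = 0" "v \<bullet> z x = 1"
      using ex_separating_vector[OF s1] by blast
    obtain w where w: "\<And>y. y \<in> span {z p', z q', z r'} \<Longrightarrow> w \<bullet> y = 0" "w \<bullet> z x = 1"
      using ex_separating_vector[OF s2] by blast
    show ?thesis
    proof (rule relation_isolate[OF c(1), of "linear_poly v * linear_poly w"])
      show "linear_poly v * linear_poly w \<in> forms d"
        using forms_mult[OF linear_poly_in_forms linear_poly_in_forms] d by (simp add: numeral_2_eq_2)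
    next
      fix j assume "j \<noteq> x"
      hence "j = k \<or> j \<in> {p, q, r, p', q', r'}" using a(1) eq by blast
      thus "c j * eval_poly (linear_poly v * linear_poly w) (z j) = 0"
        using c(2) v(1) w(1) by (auto simp: eval_poly_mult eval_linear_poly span_base)
    qed (simp add: eval_poly_mult eval_linear_poly v w)
  qed
  define bad where "bad = (\<lambda>p q r. z x \<in> span {z p, z q, z r})"
  have excl: "\<not> (bad p q u \<and> bad p q v)"
    if "distinct [p, q, u, v]" "{p, q, u, v} \<subseteq> {a1, a2, a3, a4, a5, a6}" for p q u v
    using plane_exchange[OF d, of p q u v x] that x unfolding bad_def by auto
  \<comment> \<open>Of the three planes through \<open>a1, a2\<close> and of the three complementary planes at most one each
    contains \<open>x\<close>, so one of the three splittings misses \<open>x\<close>.\<close>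
  have "\<not> (bad a1 a2 a3 \<and> bad a1 a2 a4)" "\<not> (bad a1 a2 a3 \<and> bad a1 a2 a5)"
    "\<not> (bad a1 a2 a4 \<and> bad a1 a2 a5)" "\<not> (bad a5 a6 a4 \<and> bad a5 a6 a3)"
    "\<not> (bad a4 a6 a5 \<and> bad a4 a6 a3)" "\<not> (bad a3 a6 a5 \<and> bad a3 a6 a4)"
    by (rule excl; insert a(2), auto)+
  moreover have "bad a4 a6 a5 = bad a5 a6 a4" "bad a3 a6 a5 = bad a5 a6 a3" "bad a4 a6 a3 = bad a3 a6 a4"
    by (simp_all add: bad_def insert_commute)
  ultimately consider "\<not> bad a1 a2 a3" "\<not> bad a5 a6 a4" | "\<not> bad a1 a2 a4" "\<not> bad a5 a6 a3"
    | "\<not> bad a1 a2 a5" "\<not> bad a3 a6 a4" by blast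
  thus ?thesis
  proof cases
    case 1
    thus ?thesis unfolding bad_def by (intro split[of a1 a2 a3 a5 a6 a4]) auto
  next
    case 2
    thus ?thesis unfolding bad_def by (intro split[of a1 a2 a4 a5 a6 a3]) auto
  next
    case 3
    thus ?thesis unfolding bad_def by (intro split[of a1 a2 a5 a3 a6 a4]) auto
  qed
qed (use c in simp)

section \<open>Relations in degree 3: nine points\<close>

lemma no_four_collinear:
  assumes "d = 3" "distinct [a, b, p, q]" "z p \<in> span {z a, z b}" "z q \<in> span {z a, z b}"
  shows False
proof -
  have "card {a, b, p, q} \<le> d"
    using assms by (intro card_collinear_le[of a b]) (auto intro: span_base)
  thus False using assms by simp
qed

text \<open>One of the pairings \<open>a b | e g\<close> and \<open>a e | b g\<close> works.
  Otherwise \<open>x\<close> lies on a line of each; these two lines share one of the four points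
  and hence coincide, so four points are collinear.\<close>

lemma ex_line_pair:
  assumes d: "d = 3" and dist: "distinct [a, b, e, g, x]"
  shows "\<exists>v w. v \<bullet> z x = 1 \<and> w \<bullet> z x = 1 \<and> (\<forall>j\<in>{a, b, e, g}. v \<bullet> z j = 0 \<or> w \<bullet> z j = 0)"
proof -
  define bad where "bad = (\<lambda>p q. z x \<in> span {z p, z q})"
  have excl: "\<not> (bad p q \<and> bad p r)" if "distinct [p, q, r]" "x \<notin> {p, q, r}" for p q r
  proof
    assume "bad p q \<and> bad p r"
    hence mem: "z x \<in> span {z p, z q}" "z x \<in> span {z p, z r}" by (simp_all add: bad_def)
    have "z x \<notin> span {z p}" using that by (intro pts_distinct) auto
    hence "z q \<in> span {z p, z x}" "z r \<in> span {z p, z x}" using mem span_2_exchange by blast+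
    thus False using no_four_collinear[OF d, of p x q r] that by auto
  qed
  have split: ?thesis if eq: "{p, q, p', q'} = {a, b, e, g}" and s1: "z x \<notin> span {z p, z q}"
    and s2: "z x \<notin> span {z p', z q'}" for p q p' q'
  proof -
    obtain v where v: "\<And>y. y \<in> span {z p, z q} \<Longrightarrow> v \<bullet> y = 0" "v \<bullet> z x = 1"
      using ex_separating_vector[OF s1] by blast
    obtain w where w: "\<And>y. y \<in> span {z p', z q'} \<Longrightarrow> w \<bullet> y = 0" "w \<bullet> z x = 1"
      using ex_separating_vector[OF s2] by blast
    show ?thesis unfolding eq[symmetric]
      using v w by (intro exI[of _ v] exI[of _ w]) (auto simp: span_base)
  qed
  have "bad p q = bad q p" for p q by (simp add: bad_def insert_commute)
  moreover have "\<not> (bad a b \<and> bad a e)" "\<not> (bad b a \<and> bad b g)" "\<not> (bad e g \<and> bad e a)"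
    "\<not> (bad g e \<and> bad g b)"
    by (rule excl; insert dist, auto)+
  ultimately consider "\<not> bad a b" "\<not> bad e g" | "\<not> bad a e" "\<not> bad b g" by blast
  thus ?thesis
  proof cases
    case 1
    thus ?thesis unfolding bad_def by (intro split[of a b e g]) auto
  next
    case 2
    thus ?thesis unfolding bad_def by (intro split[of a e b g]) auto
  qed
qed

lemma three_lines_in_forms:
  "d = 3 \<Longrightarrow> linear_poly u * linear_poly v * linear_poly w \<in> forms d"
  using forms_mult[OF forms_mult[OF linear_poly_in_forms linear_poly_in_forms] linear_poly_in_forms]
  by (simp add: numeral_3_eq_3)

lemma relation_on_three_points:
  assumes d: "d = 3" and c: "relation c" "\<And>x. x \<notin> {i, j, l} \<Longrightarrow> c x = 0" and "i \<noteq> j" "i \<noteq> l"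
  shows "c i = 0"
proof -
  obtain v where v: "\<And>y. y \<in> span {z j} \<Longrightarrow> v \<bullet> y = 0" "v \<bullet> z i = 1"
    using ex_separating_vector[OF pts_distinct[OF \<open>i \<noteq> j\<close>]] by blast
  obtain w where w: "\<And>y. y \<in> span {z l} \<Longrightarrow> w \<bullet> y = 0" "w \<bullet> z i = 1"
    using ex_separating_vector[OF pts_distinct[OF \<open>i \<noteq> l\<close>]] by blast
  show ?thesis
  \<comment> \<open>The factor \<open>v\<close> is repeated to reach degree 3.\<close>
  proof (rule relation_isolate[OF c(1) three_lines_in_forms[OF d, of v v w]])
    fix x assume "x \<noteq> i"
    hence "x = j \<or> x = l \<or> c x = 0" using c(2)[of x] by blast
    thus "c x * eval_poly (linear_poly v * linear_poly v * linear_poly w) (z x) = 0"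
      using v(1)[of "z j"] w(1)[of "z l"] by (auto simp: eval_poly_mult eval_linear_poly span_base)
  qed (simp add: eval_poly_mult eval_linear_poly v w)
qed

text \<open>For \<open>x\<close> other than \<open>k\<close> and off the three collinear points, a
  linear form vanishing at these three and two covering the remaining four points multiply to a
  cubic that isolates \<open>x\<close>. So the relation lives on three points only, where it
  vanishes too.\<close>

lemma relation_eq_0_collinear:
  assumes d: "d = 3" and card: "CARD('m) = 9" and c: "relation c" "c k = 0"
    and ijl: "distinct [i, j, l, k]" "z l \<in> span {z i, z j}"
  shows "c = (\<lambda>_. 0)"
proof -
  have supp: "c x = 0" if x: "x \<notin> {i, j, l}" for x
  proof (cases "x = k")
    case False
    have "card (UNIV - {i, j, l, k, x}) = 4" 
      using card False ijl(1) x by (subst card_Diff_subset) auto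
    then obtain a b e g where abeg: "UNIV - {i, j, l, k, x} = {a, b, e, g}" "distinct [a, b, e, g]"
      by (metis card_4_elements finite)
    hence "x \<notin> {a, b, e, g}" by blast
    hence "distinct [a, b, e, g, x]" using abeg(2) by auto
    then obtain v w where vw: "v \<bullet> z x = 1" "w \<bullet> z x = 1"
      "\<And>j. j \<in> {a, b, e, g} \<Longrightarrow> v \<bullet> z j = 0 \<or> w \<bullet> z j = 0"
      using ex_line_pair[OF d] by meson
    have "z x \<notin> span {z i, z j}" using no_four_collinear[OF d, of i j l x] ijl x by auto
    then obtain u where u: "\<And>y. y \<in> span {z i, z j} \<Longrightarrow> u \<bullet> y = 0" "u \<bullet> z x = 1"
      using ex_separating_vector by blast
    show ?thesis
    proof (rule relation_isolate[OF c(1) three_lines_in_forms[OF d, of u v w]])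
      fix y assume "y \<noteq> x"
      hence "y = k \<or> y \<in> {i, j, l} \<or> y \<in> {a, b, e, g}" using abeg(1) by blast
      thus "c y * eval_poly (linear_poly u * linear_poly v * linear_poly w) (z y) = 0"
        using c(2) u(1) vw(3)[of y] ijl(2)
        by (auto simp: eval_poly_mult eval_linear_poly span_base)
    qed (simp add: eval_poly_mult eval_linear_poly u vw)
  qed (use c in simp)
  have "c i = 0" "c j = 0" "c l = 0"
    using relation_on_three_points[OF d c(1), of i j l] relation_on_three_points[OF d c(1), of j i l]
      relation_on_three_points[OF d c(1), of l i j] supp ijl(1) by auto
  thus ?thesis using supp by (intro ext) (metis insertE singletonD)
qed


text \<open>In the coordinates of three points \<open>p, q, r\<close>, the cubics \<open>n e e'\<close> with \<open>n\<close> a line through two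
  points and \<open>e, e'\<close> sides of the triangle \<open>p q r\<close> leave three points in the relation. Varying
  the sides shows that the images of these three points under the quadratic transformation are
  dependent. Hence all eight points lie on one conic.\<close>

lemma relation_eq_0_no_three_collinear:
  assumes n: "CARD('n) = 3" and d: "d = 3" and card: "CARD('m) = 9" and c: "relation c" "c k = 0"
    and no3: "no_three_collinear (UNIV - {k})"
  shows "c u = 0"
proof (rule ccontr)
  assume cu: "c u \<noteq> 0"
  hence "u \<noteq> k" using c by auto
  hence "card (UNIV - {k, u}) = Suc 6" using card by (simp add: card_Diff_subset)
  then obtain p A where pA: "UNIV - {k, u} = insert p A" "p \<notin> A" "card A = 6"
    unfolding card_Suc_eq by blast
  obtain q r v a1 a2 a3 where A: "A = {q, r, v, a1, a2, a3}" "distinct [q, r, v, a1, a2, a3]"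
    using card_6_elements[OF _ pA(3)] by (metis finite)
  define J where "J = UNIV - {k}"
  have J: "J = {p, q, r, u, v, a1, a2, a3}" "u \<in> J"
    using pA(1) A(1) \<open>u \<noteq> k\<close> unfolding J_def by auto
  have "u \<notin> insert p A" using pA(1) by blast
  hence dist: "distinct [p, q, r, u, v, a1, a2, a3]" using A pA(2) by auto
  have no3: "no_three_collinear J" using no3 by (simp add: J_def)
  note ind = no_three_collinearD[OF no3]
  have "z p \<notin> span {z q, z r}" "z q \<notin> span {z p, z r}" "z r \<notin> span {z p, z q}"
    using dist by (intro ind; auto simp: J)+
  then obtain e1 e2 e3 where e:
    "\<And>y. y \<in> span {z q, z r} \<Longrightarrow> e1 \<bullet> y = 0" "e1 \<bullet> z p = 1"
    "\<And>y. y \<in> span {z p, z r} \<Longrightarrow> e2 \<bullet> y = 0" "e2 \<bullet> z q = 1"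
    "\<And>y. y \<in> span {z p, z q} \<Longrightarrow> e3 \<bullet> y = 0" "e3 \<bullet> z r = 1"
    using ex_separating_vector by metis
  have e0: "e1 \<bullet> z q = 0" "e1 \<bullet> z r = 0" "e2 \<bullet> z p = 0" "e2 \<bullet> z r = 0" "e3 \<bullet> z p = 0" "e3 \<bullet> z q = 0"
    using e by (auto simp: span_base)
  \<comment> \<open>\<open>e1\<close>, \<open>e2\<close>, \<open>e3\<close> are dual to
    \<open>z p\<close>, \<open>z q\<close>, \<open>z r\<close>, so they give the coordinates; their
    zero lines are the sides of the triangle.\<close>
  define X Y W where "X = (\<lambda>j. e1 \<bullet> z j)" and "Y = (\<lambda>j. e2 \<bullet> z j)" and "W = (\<lambda>j. e3 \<bullet> z j)"
  have coord: "z j = X j *\<^sub>R z p + Y j *\<^sub>R z q + W j *\<^sub>R z r" for j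
  proof -
    have "independent {z p, z q, z r}"
    proof (rule independent_if_scalars_zero)
      fix g x assume g: "(\<Sum>x\<in>{z p, z q, z r}. g x *\<^sub>R x) = 0" "x \<in> {z p, z q, z r}"
      have "g (z p) *\<^sub>R z p + g (z q) *\<^sub>R z q + g (z r) *\<^sub>R z r = 0"
        using g(1) dist inj_z by (simp add: inj_eq add.assoc)
      thus "g x = 0"
        using three_points_independent[OF no3, of p q r] dist g(2) by (auto simp: J)
    qed simp
    moreover have "card {z p, z q, z r} = 3" using dist inj_z by (simp add: inj_eq)
    ultimately have "span {z p, z q, z r} = UNIV"
      using n by (intro dim_eq_full[THEN iffD1]) (simp add: dim_eq_card_independent)
    then obtain x y w where "z j = x *\<^sub>R z p + y *\<^sub>R z q + w *\<^sub>R z r"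
      using mem_span_3[of "z j" "z p" "z q" "z r"] by auto
    thus ?thesis using e e0 by (simp add: X_def Y_def W_def inner_add_right)
  qed
  have nz: "X j \<noteq> 0 \<and> Y j \<noteq> 0 \<and> W j \<noteq> 0" if j: "j \<in> J - {p, q, r}" for j
  proof -
    have "z j \<notin> span {z q, z r}" "z j \<notin> span {z p, z r}" "z j \<notin> span {z p, z q}"
      using j dist by (intro ind; auto simp: J)+
    thus ?thesis using coord[of j] unfolding mem_span_2 by force
  qed
  have nzuv: "X u \<noteq> 0" "Y u \<noteq> 0" "W u \<noteq> 0" "X v \<noteq> 0" "Y v \<noteq> 0" "W v \<noteq> 0"
    using nz[of u] nz[of v] dist by (auto simp: J)
  have conic: "\<exists>s t. 1 / X j = s / X u + t / X v \<and> 1 / Y j = s / Y u + t / Y v \<and> 1 / W j = s / W u + t / W v"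
    if J_eq: "J = {p, q, r, u, v, j, g, h}" and dj: "distinct [p, q, r, u, v, j, g, h]" for j g h
  proof -
    have "z u \<notin> span {z g, z h}" using dj by (intro ind) (auto simp: J_eq)
    then obtain n where n: "\<And>y. y \<in> span {z g, z h} \<Longrightarrow> n \<bullet> y = 0" "n \<bullet> z u = 1"
      using ex_separating_vector by blast
    \<comment> \<open>The line \<open>n\<close> removes \<open>g\<close> and \<open>h\<close>, the
      two sides remove \<open>p\<close>, \<open>q\<close>, \<open>r\<close>, and
      \<open>c k = 0\<close> removes \<open>k\<close>.\<close>
    have cubic: "c u * (n \<bullet> z u) * (e \<bullet> z u) * (e' \<bullet> z u) + c v * (n \<bullet> z v) * (e \<bullet> z v) * (e' \<bullet> z v)
        + c j * (n \<bullet> z j) * (e \<bullet> z j) * (e' \<bullet> z j) = 0"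
      if "\<And>y. y \<in> {p, q, r} \<Longrightarrow> e \<bullet> z y = 0 \<or> e' \<bullet> z y = 0" for e e'
    proof -
      have "(\<Sum>y\<in>{u, v, j}. c y * eval_poly (linear_poly n * linear_poly e * linear_poly e') (z y)) = 0"
      proof (rule relation_supported[OF c(1) three_lines_in_forms[OF d]])
        fix y assume "y \<notin> {u, v, j}"
        hence "y = k \<or> y \<in> {p, q, r} \<or> y \<in> {g, h}" using J_eq J_def by blast
        thus "c y * eval_poly (linear_poly n * linear_poly e * linear_poly e') (z y) = 0"
          using c(2) n(1) that[of y] by (auto simp: eval_poly_mult eval_linear_poly span_base)
      qed
      thus ?thesis using dj by (simp add: eval_poly_mult eval_linear_poly algebra_simps)
    qed
    \<comment> \<open>The products of all three coordinates are put into the coefficients, so each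
      choice of two sides leaves the reciprocal of the third coordinate. The factor
      \<open>n \<bullet> z u\<close> is 1.\<close>
    define \<alpha> \<beta> \<delta> where "\<alpha> = c u * X u * Y u * W u" and "\<beta> = c v * (n \<bullet> z v) * X v * Y v * W v"
      and "\<delta> = c j * (n \<bullet> z j) * X j * Y j * W j"
    have nzj: "X j \<noteq> 0" "Y j \<noteq> 0" "W j \<noteq> 0" using nz[of j] dj by (auto simp: J_eq)
    have rel: "\<alpha> / X u + \<beta> / X v + \<delta> / X j = 0" "\<alpha> / Y u + \<beta> / Y v + \<delta> / Y j = 0"
      "\<alpha> / W u + \<beta> / W v + \<delta> / W j = 0"
      using cubic[of e2 e3] cubic[of e1 e3] cubic[of e1 e2] e0 nzj nzuv n(2)
      by (auto simp: \<alpha>_def \<beta>_def \<delta>_def X_def Y_def W_def mult_ac)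
    have \<alpha>: "\<alpha> \<noteq> 0" using cu nzuv by (simp add: \<alpha>_def)
    \<comment> \<open>Otherwise the images of \<open>u\<close> and \<open>v\<close> would be
      proportional, and so would the points themselves.\<close>
    have "\<delta> \<noteq> 0"
    proof
      assume "\<delta> = 0"
      hence "X v = - (\<beta> / \<alpha>) * X u" "Y v = - (\<beta> / \<alpha>) * Y u" "W v = - (\<beta> / \<alpha>) * W u"
        using rel \<alpha> nzuv by (auto simp: field_simps add_eq_0_iff)
      hence "z v = (- (\<beta> / \<alpha>)) *\<^sub>R z u"
        by (subst coord[of v], subst coord[of u]) (simp add: scaleR_add_right)
      moreover have "z v \<notin> span {z u}" using dist by (intro pts_distinct) auto
      ultimately show False by (metis span_base span_mul singletonI)
    qed
    hence "1 / X j = (- \<alpha> / \<delta>) / X u + (- \<beta> / \<delta>) / X v" "1 / Y j = (- \<alpha> / \<delta>) / Y u + (- \<beta> / \<delta>) / Y v"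
      "1 / W j = (- \<alpha> / \<delta>) / W u + (- \<beta> / \<delta>) / W v"
      using rel nzj nzuv by (auto simp: field_simps add_eq_0_iff)
    thus ?thesis by blast
  qed
  have "card J \<le> 2 * d"
  proof (rule card_conic_le[OF no3 _ _ coord])
    show "distinct [p, q, r, u, v]" using dist by auto
    fix j assume "j \<in> J - {p, q, r}"
    then consider "j = u" | "j = v" | "j = a1" | "j = a2" | "j = a3" using J(1) by blast
    thus "\<exists>s t. 1 / X j = s / X u + t / X v \<and> 1 / Y j = s / Y u + t / Y v \<and> 1 / W j = s / W u + t / W v"
    proof cases
      case 1
      thus ?thesis by (intro exI[of _ 1] exI[of _ 0]) simp
    next
      case 2
      thus ?thesis by (intro exI[of _ 0] exI[of _ 1]) simp
    next
      case 3
      show ?thesis unfolding 3 using dist J by (intro conic[of a1 a2 a3]) auto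
    next
      case 4
      show ?thesis unfolding 4 using dist J by (intro conic[of a2 a1 a3]) auto
    next
      case 5
      show ?thesis unfolding 5 using dist J by (intro conic[of a3 a1 a2]) auto
    qed
  qed (use J in auto)
  moreover have "card J = 8" using card by (simp add: J_def card_Diff_subset)
  ultimately show False using d by simp
qed

lemma relation_eq_0_cubics:
  assumes "CARD('n) = 3" and d: "d = 3" and card: "CARD('m) = 9" and c: "relation c" "c k = 0"
  shows "c = (\<lambda>_. 0)"
proof (cases "no_three_collinear (UNIV - {k})")
  case True
  thus ?thesis using relation_eq_0_no_three_collinear assms by blast
next
  case False
  then obtain i j l where "distinct [i, j, l, k]" "z l \<in> span {z i, z j}"
    unfolding no_three_collinear_def by auto
  thus ?thesis using relation_eq_0_collinear[OF d card c] by blast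
qed

end

section \<open>The image of the sums of squares\<close>

interpretation rpoly: vector_space "scale_poly :: real \<Rightarrow> 'n::finite rpoly \<Rightarrow> 'n rpoly"
  by unfold_locales (simp_all add: algebra_simps single_add Poly_Mapping.mult_single flip: mult.assoc)

text \<open>Read along an enumeration of the variables, exponent vectors become lists of length
  \<open>CARD('n)\<close> with sum \<open>d\<close>, which are counted by stars and bars.\<close>

lemma card_monomials_le:
  fixes d :: nat
  defines "M \<equiv> {m :: 'n::finite \<Rightarrow>\<^sub>0 nat. (\<Sum>i\<in>UNIV. Poly_Mapping.lookup m i) = d}"
  shows "finite M" "card M \<le> (d + CARD('n) - 1) choose d"
proof -
  obtain xs :: "'n list" where xs: "set xs = UNIV" "distinct xs"
    using finite_distinct_list[of "UNIV :: 'n set"] by auto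
  define L where "L = {l :: nat list. length l = CARD('n) \<and> sum_list l = d}"
  have card_L: "card L = (d + CARD('n) - 1) choose d"
    by (simp add: L_def card_length_sum_list)
  have "CARD('n) \<ge> 1" by (simp add: Suc_leI)
  hence "d \<le> d + CARD('n) - 1" by linarith
  \<comment> \<open>Infinite sets have cardinality 0, so a positive one shows that \<open>L\<close>
    is finite.\<close>
  hence "card L > 0" unfolding card_L by (rule zero_less_binomial)
  hence "finite L" using card_ge_0_finite by blast
  have inj: "inj_on (\<lambda>m. map (Poly_Mapping.lookup m) xs) M"
  proof (rule inj_onI)
    fix m m' :: "'n \<Rightarrow>\<^sub>0 nat"
    assume "map (Poly_Mapping.lookup m) xs = map (Poly_Mapping.lookup m') xs"
    thus "m = m'" using xs(1) by (intro poly_mapping_eqI) (simp add: map_eq_conv)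
  qed
  have sub: "(\<lambda>m. map (Poly_Mapping.lookup m) xs) ` M \<subseteq> L"
    using xs by (auto simp: L_def M_def distinct_card[symmetric] sum_list_distinct_conv_sum_set)
  show "finite M" using finite_subset[OF sub \<open>finite L\<close>] inj by (rule finite_imageD)
  show "card M \<le> (d + CARD('n) - 1) choose d"
    using card_inj_on_le[OF inj sub \<open>finite L\<close>] card_L by simp
qed

lemma form_in_span_monomials:
  assumes "p \<in> forms d"
  shows "p \<in> rpoly.span ((\<lambda>m. Poly_Mapping.single m 1) ` {m. (\<Sum>i\<in>UNIV. Poly_Mapping.lookup m i) = d})"
proof (subst rpoly_eq_sum_single[of p], rule rpoly.span_sum)
  fix m assume m: "m \<in> Poly_Mapping.keys p"
  have eq: "Poly_Mapping.single m (Poly_Mapping.lookup p m) =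
      scale_poly (Poly_Mapping.lookup p m) (Poly_Mapping.single m 1)"
    by (simp add: Poly_Mapping.mult_single)
  show "Poly_Mapping.single m (Poly_Mapping.lookup p m) \<in>
      rpoly.span ((\<lambda>m. Poly_Mapping.single m 1) ` {m. (\<Sum>i\<in>UNIV. Poly_Mapping.lookup m i) = d})"
    unfolding eq using assms m
    by (intro rpoly.span_scale rpoly.span_base imageI) (simp add: forms_def)
qed

lemma card_independent_forms_le:
  fixes g :: "'a \<Rightarrow> 'n::finite rpoly"
  assumes A: "finite A" "\<And>a. a \<in> A \<Longrightarrow> g a \<in> forms d"
    and indep: "\<And>h a. (\<Sum>a\<in>A. scale_poly (h a) (g a)) = 0 \<Longrightarrow> a \<in> A \<Longrightarrow> h a = 0"
  shows "card A \<le> (d + CARD('n) - 1) choose d"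
proof -
  have inj: "inj_on g A"
  proof (rule inj_onI, rule ccontr)
    fix a b assume ab: "a \<in> A" "b \<in> A" "g a = g b" "a \<noteq> b"
    \<comment> \<open>Equal members of the family would satisfy a relation with coefficients 1 and
      -1.\<close>
    define h :: "'a \<Rightarrow> real" where "h = (\<lambda>x. if x = a then 1 else if x = b then - 1 else 0)"
    have "(\<Sum>x\<in>A. scale_poly (h x) (g x)) = (\<Sum>x\<in>{a, b}. scale_poly (h x) (g x))"
      using A(1) ab by (intro sum.mono_neutral_right) (auto simp: h_def)
    also have "\<dots> = 0" using ab by (simp add: h_def single_uminus)
    finally show False using indep[of h a] ab by (simp add: h_def)
  qed
  have "rpoly.independent (g ` A)"
  proof (rule rpoly.independent_if_scalars_zero)
    fix h x assume "(\<Sum>x\<in>g ` A. scale_poly (h x) x) = 0" "x \<in> g ` A"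
    thus "h x = 0" using indep[of "h \<circ> g"] inj by (auto simp: sum.reindex)
  qed (use A in simp)
  moreover have "g ` A \<subseteq> rpoly.span ((\<lambda>m. Poly_Mapping.single m 1) ` {m. (\<Sum>i\<in>UNIV. Poly_Mapping.lookup m i) = d})"
    using A(2) form_in_span_monomials by blast
  ultimately have "card (g ` A) \<le>
      card ((\<lambda>m. Poly_Mapping.single m (1::real)) ` {m :: 'n \<Rightarrow>\<^sub>0 nat. (\<Sum>i\<in>UNIV. Poly_Mapping.lookup m i) = d})"
    using rpoly.independent_span_bound card_monomials_le(1) finite_imageI by blast
  also have "\<dots> \<le> (d + CARD('n) - 1) choose d"
    using card_image_le[OF card_monomials_le(1)] card_monomials_le(2) order_trans by blast
  finally show ?thesis using inj by (simp add: card_image)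
qed

lemma subspace_eval_map_forms: "subspace (eval_map z ` forms d)"
proof (rule subspaceI)
  show "0 \<in> eval_map z ` forms d"
    by (rule image_eqI[of _ _ 0]) (simp_all add: eval_map_def vec_eq_iff)
next
  fix x y assume "x \<in> eval_map z ` forms d" "y \<in> eval_map z ` forms d"
  then obtain p q where pq: "p \<in> forms d" "q \<in> forms d" "x = eval_map z p" "y = eval_map z q" by blast
  thus "x + y \<in> eval_map z ` forms d"
    by (intro image_eqI[of _ _ "p + q"]) (auto simp: eval_map_def vec_eq_iff eval_poly_add forms_add)
next
  fix c x assume "x \<in> eval_map z ` forms d"
  then obtain p where "p \<in> forms d" "x = eval_map z p" by blast
  thus "c *\<^sub>R x \<in> eval_map z ` forms d"
    by (intro image_eqI[of _ _ "scale_poly c p"])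
      (auto simp: eval_map_def vec_eq_iff eval_poly_scale forms_scale)
qed

context zero_configuration
begin

lemma relation_iff: "relation (($) u) \<longleftrightarrow> (\<forall>y\<in>eval_map z ` forms d. u \<bullet> y = 0)"
  by (simp add: relation_def eval_map_def inner_vec_def)

text \<open>Without a relation every value vector is attained. The forms dual to the points,
  together with the \<open>f i\<close>, would then be independent and exceed the dimension of the
  space of forms.\<close>

lemma ex_relation:
  assumes I: "finite I" and card: "CARD('m) + card I > (d + CARD('n) - 1) choose d"
    and w: "inj_on (\<lambda>i. gradient (f i) w) I" "vec.independent ((\<lambda>i. gradient (f i) (w :: complex ^ 'n)) ` I)"
  shows "\<exists>u. u \<noteq> 0 \<and> relation (($) u)"
proof (cases "eval_map z ` forms d = UNIV")
  case False
  then obtain x where "x \<notin> span (eval_map z ` forms d)"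
    using subspace_eval_map_forms span_eq_iff by blast
  then obtain u where u: "\<And>y. y \<in> span (eval_map z ` forms d) \<Longrightarrow> u \<bullet> y = 0" "u \<bullet> x = 1"
    using ex_separating_vector by blast
  thus ?thesis unfolding relation_iff by (intro exI[of _ u]) (auto simp: span_base)
next
  case True
  have "\<forall>j. \<exists>q. q \<in> forms d \<and> eval_map z q = axis j 1"
    using True by (metis UNIV_I imageE)
  then obtain q where q: "\<And>j. q j \<in> forms d" "\<And>j. eval_map z (q j) = axis j 1" by metis
  have q_eval: "eval_poly (q j) (z k) = (if j = k then 1 else 0)" for j k
    using arg_cong[OF q(2)[of j], of "\<lambda>v. v $ k"] by (simp add: eval_map_def axis_def)
  have "card (UNIV <+> I :: ('m + 'i) set) \<le> (d + CARD('n) - 1) choose d"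
  proof (rule card_independent_forms_le)
    show "finite (UNIV <+> I :: ('m + 'i) set)" using I by simp
    show "case_sum q f a \<in> forms d" if "a \<in> UNIV <+> I" for a
      using that q(1) forms by auto
  next
    fix h :: "'m + 'i \<Rightarrow> real" and a :: "'m + 'i"
    assume "(\<Sum>a\<in>UNIV <+> I. scale_poly (h a) (case_sum q f a)) = 0" and a: "a \<in> UNIV <+> I"
    hence sum0: "(\<Sum>j\<in>UNIV. scale_poly (h (Inl j)) (q j)) + (\<Sum>i\<in>I. scale_poly (h (Inr i)) (f i)) = 0"
      using I by (simp add: sum.Plus o_def)
    \<comment> \<open>Evaluation at \<open>z k\<close> kills every \<open>f i\<close> and every dual
      form except \<open>q k\<close>.\<close>
    have Inl: "h (Inl k) = 0" for k
    proof -
      have "eval_poly ((\<Sum>j\<in>UNIV. scale_poly (h (Inl j)) (q j)) + (\<Sum>i\<in>I. scale_poly (h (Inr i)) (f i))) (z k) = h (Inl k)"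
        using zero by (simp add: eval_poly_add eval_poly_sum eval_poly_scale q_eval if_distrib cong: if_cong)
      thus ?thesis using sum0 by simp
    qed
    hence "(\<Sum>i\<in>I. scale_poly (h (Inr i)) (f i)) = 0" using sum0 by simp
    \<comment> \<open>Independence of the gradients at \<open>w\<close> passes to the
      \<open>f i\<close>.\<close>
    hence "gradient (\<Sum>i\<in>I. scale_poly (h (Inr i)) (f i)) w = 0" by simp
    hence grad0: "(\<Sum>i\<in>I. complex_of_real (h (Inr i)) *s gradient (f i) w) = 0"
      by (simp add: gradient_sum gradient_scale)
    define G where "G = (\<lambda>i. gradient (f i) w)"
    have G: "inj_on G I" "vec.independent (G ` I)" "(\<Sum>i\<in>I. complex_of_real (h (Inr i)) *s G i) = 0"
      using w grad0 by (simp_all add: G_def)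
    \<comment> \<open>The coefficients are carried over from indices to gradients, as independence
      concerns the set of gradients.\<close>
    define H where "H = (\<lambda>v. complex_of_real (h (Inr (the_inv_into I G v))))"
    have H: "H (G i) = complex_of_real (h (Inr i))" if "i \<in> I" for i
      using that G(1) by (simp add: H_def the_inv_into_f_f)
    have "(\<Sum>v\<in>G ` I. H v *s v) = 0"
      unfolding sum.reindex[OF G(1)] o_def using G(3) H by simp
    hence "H v = 0" if "v \<in> G ` I" for v
      using vec.independentD[OF G(2) finite_imageI[OF I] order_refl] that by blast
    hence "h (Inr i) = 0" if "i \<in> I" for i using H that by fastforce
    thus "h a = 0" using a Inl by auto
  qed
  moreover have "card (UNIV <+> I :: ('m + 'i) set) = CARD('m) + card I" using I by (simp add: card_Plus)
  ultimately show ?thesis using card by simp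
qed

text \<open>By \<open>unique\<close> a nonzero relation has no zero coefficient, and any two
  relations are proportional.\<close>

lemma eval_map_forms_eq_hyperplane:
  assumes "\<exists>u. u \<noteq> 0 \<and> relation (($) u)" and unique: "\<And>c k. relation c \<Longrightarrow> c k = 0 \<Longrightarrow> c = (\<lambda>_. 0)"
  obtains u where "\<And>j. u $ j \<noteq> 0" "eval_map z ` forms d = {y. u \<bullet> y = 0}"
proof -
  obtain u where u: "u \<noteq> 0" "relation (($) u)" using assms(1) by blast
  have nz: "u $ j \<noteq> 0" for j
    using unique[OF u(2), of j] u(1) by (auto simp: vec_eq_iff fun_eq_iff)
  have "v = 0" if "\<And>y. y \<in> eval_map z ` forms d \<Longrightarrow> v \<bullet> y = 0" "v $ k = 0" for v k
    using unique[of "($) v" k] that by (auto simp: relation_iff vec_eq_iff fun_eq_iff)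
  hence "eval_map z ` forms d = {y. u \<bullet> y = 0}"
    using u(2) nz by (intro subspace_eq_hyperplane subspace_eval_map_forms) (auto simp: relation_iff)
  thus ?thesis using nz that by blast
qed

end

section \<open>The image cone\<close>

text \<open>Values of sums of squares are coordinatewise sums of squares of vectors in the
  hyperplane. Conversely, the two vectors obtained from a closed polygon lift to forms
  \<open>p\<close> and \<open>q\<close>.\<close>

lemma eval_map_sos_forms:
  fixes z :: "'m::finite \<Rightarrow> real ^ 'n::finite"
  assumes \<epsilon>: "\<And>j. \<bar>\<epsilon> j\<bar> = 1" and image: "eval_map z ` forms d = {y. (\<Sum>j\<in>UNIV. \<epsilon> j * y $ j) = 0}"
  shows "eval_map z ` sos_forms d =
    {x. (\<forall>j. 0 \<le> x $ j) \<and> (\<forall>k. (\<Sum>j\<in>UNIV. sqrt (x $ j)) \<ge> 2 * sqrt (x $ k))}" (is "_ = ?C")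
proof (intro equalityI subsetI)
  fix x assume "x \<in> eval_map z ` sos_forms d"
  then obtain k :: nat and q where q: "\<And>i. i < k \<Longrightarrow> q i \<in> forms d" "x = eval_map z (\<Sum>i<k. (q i)\<^sup>2)"
    unfolding sos_forms_def by blast
  define y where "y = (\<lambda>i. eval_map z (q i))"
  have x: "x $ j = (\<Sum>i<k. (y i $ j)\<^sup>2)" for j
    by (simp add: q(2) y_def eval_map_def eval_poly_sum eval_poly_power2)
  have "(\<Sum>j\<in>UNIV. \<epsilon> j * y i $ j) = 0" if "i < k" for i
    using q(1)[OF that] image unfolding y_def by blast
  thus "x \<in> ?C"
    using sqrt_sum_squares_hyperplane[of \<epsilon> k y, OF \<epsilon>] by (auto simp: x intro: sum_nonneg)
next
  fix x assume "x \<in> ?C"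
  then obtain a b where ab: "(\<Sum>j\<in>UNIV. \<epsilon> j * a $ j) = 0" "(\<Sum>j\<in>UNIV. \<epsilon> j * b $ j) = 0"
    "\<And>j. x $ j = (a $ j)\<^sup>2 + (b $ j)\<^sup>2"
    using ex_two_squares_hyperplane[of \<epsilon> x, OF \<epsilon>] by blast
  then obtain p q where pq: "p \<in> forms d" "q \<in> forms d" "a = eval_map z p" "b = eval_map z q"
    using image by blast
  define r where "r = (\<lambda>i::nat. if i = 0 then p else q)"
  have sq: "(\<Sum>i<2. (r i)\<^sup>2) = p\<^sup>2 + q\<^sup>2" by (simp add: r_def numeral_2_eq_2)
  have "p\<^sup>2 + q\<^sup>2 \<in> forms (2 * d)"
    using forms_mult[OF pq(1,1)] forms_mult[OF pq(2,2)] by (simp add: power2_eq_square mult_2 forms_add)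
  moreover have "\<forall>i<2. r i \<in> forms d" using pq by (simp add: r_def)
  ultimately have "p\<^sup>2 + q\<^sup>2 \<in> sos_forms d"
    unfolding sos_forms_def using sq[symmetric] by (intro CollectI conjI exI[of _ 2] exI[of _ r]) auto
  moreover have "x = eval_map z (p\<^sup>2 + q\<^sup>2)"
    using ab(3) pq by (simp add: vec_eq_iff eval_map_def eval_poly_add eval_poly_power2)
  ultimately show "x \<in> eval_map z ` sos_forms d" by blast
qed

text \<open>Scaling \<open>z j\<close> by a \<open>d\<close>-th root of
  \<open>\<bar>u $ j\<bar>\<close> multiplies values of forms by \<open>\<bar>u $ j\<bar>\<close>,
  so only the signs remain in the relation.\<close>

lemma eval_map_rescaled:
  fixes z :: "'m::finite \<Rightarrow> real ^ 'n::finite"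
  assumes d: "d > 0" and u: "\<And>j. u $ j \<noteq> 0" and image: "eval_map z ` forms d = {y. u \<bullet> y = 0}"
  defines "z' \<equiv> (\<lambda>j. root d \<bar>u $ j\<bar> *\<^sub>R z j)"
  shows "eval_map z' ` forms d = {y. (\<Sum>j\<in>UNIV. sgn (u $ j) * y $ j) = 0}"
proof -
  have ev: "eval_poly q (z' j) = \<bar>u $ j\<bar> * eval_poly q (z j)" if "q \<in> forms d" for q j
    using eval_poly_homogeneous[OF that, of "root d \<bar>u $ j\<bar>" "z j"] d
    by (simp add: z'_def scalar_mult_eq_scaleR)
  show ?thesis
  proof (intro equalityI subsetI)
    fix y assume "y \<in> eval_map z' ` forms d"
    then obtain q where q: "q \<in> forms d" "y = eval_map z' q" by blast
    have "u \<bullet> eval_map z q = 0" using image q(1) by blast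
    thus "y \<in> {y. (\<Sum>j\<in>UNIV. sgn (u $ j) * y $ j) = 0}"
      using ev[OF q(1)] by (simp add: q(2) eval_map_def inner_vec_def mult_sgn_abs flip: mult.assoc)
  next
    fix y assume y: "y \<in> {y. (\<Sum>j\<in>UNIV. sgn (u $ j) * y $ j) = 0}"
    define y' where "y' = (\<chi> j. y $ j / \<bar>u $ j\<bar>)"
    have "u $ j * y' $ j = sgn (u $ j) * y $ j" for j
      using u[of j] by (simp add: y'_def real_sgn_eq)
    hence "u \<bullet> y' = 0" using y by (simp add: inner_vec_def)
    then obtain q where q: "q \<in> forms d" "y' = eval_map z q" using image by blast
    have "y = eval_map z' q"
    proof (rule vec_eq_iff[THEN iffD2], rule allI)
      fix j
      have "y' $ j = eval_poly q (z j)" using q(2) by (simp add: eval_map_def)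
      thus "y $ j = eval_map z' q $ j" using ev[OF q(1), of j] u[of j] by (simp add: eval_map_def y'_def field_simps)
    qed
    thus "y \<in> eval_map z' ` forms d" using q(1) by blast
  qed
qed

lemma span_complexify_scale:
  assumes "c \<noteq> 0"
  shows "vec.span {complexify (c *\<^sub>R x)} = vec.span {complexify x}"
proof -
  have eq: "complexify (c *\<^sub>R x) = complex_of_real c *s complexify x"
    "complexify x = complex_of_real (1 / c) *s complexify (c *\<^sub>R x)"
    using assms by (simp_all add: complexify_def vec_eq_iff)
  show ?thesis
    unfolding vec.span_eq using eq
    by (metis empty_subsetI insert_subset singletonI vec.span_base vec.span_scale)
qed

theorem theorem1p5:
  fixes d :: nat
    and f :: "nat \<Rightarrow> 'n::finite rpoly"
    and \<gamma> :: "'m::finite \<Rightarrow> (complex ^ 'n) set"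
  assumes "(CARD('n) = 3 \<and> 2 * d = 6 \<and> CARD('m) = 9) \<or>
           (CARD('n) = 4 \<and> 2 * d = 4 \<and> CARD('m) = 8)"
    and "\<And>i. i \<in> {1..CARD('n) - 1} \<Longrightarrow> f i \<in> forms d"
    and "intersect_transversely {1..CARD('n) - 1} f"
    and "bij_betw \<gamma> UNIV (common_zeros {1..CARD('n) - 1} f)"
    and "\<And>j. real_point (\<gamma> j)"
  shows "\<exists>z :: 'm \<Rightarrow> real ^ 'n.
           (\<forall>j. affine_representative (complexify (z j)) (\<gamma> j)) \<and>
           eval_map z ` sos_forms d =
             {x. (\<forall>j. 0 \<le> x $ j) \<and> (\<forall>k. (\<Sum>j\<in>UNIV. sqrt (x $ j)) \<ge> 2 * sqrt (x $ k))}"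
proof -
  let ?I = "{1..CARD('n) - 1}"
  have cases: "CARD('n) = 3 \<and> d = 3 \<and> CARD('m) = 9 \<or> CARD('n) = 4 \<and> d = 2 \<and> CARD('m) = 8"
    using assms(1) by auto
  obtain z :: "'m \<Rightarrow> real ^ 'n" where z: "\<And>j. affine_representative (complexify (z j)) (\<gamma> j)"
    using assms(5) unfolding real_point_def by metis
  have \<gamma>: "\<gamma> j \<in> common_zeros ?I f" for j
    using assms(4) by (auto simp: bij_betw_def)
  interpret zero_configuration ?I f d z
  proof
    show "finite (common_zeros ?I f)" using assms(3) by (simp add: intersect_transversely_def)
    show "f i \<in> forms d" if "i \<in> ?I" for i using that by (rule assms(2))
    show "eval_poly (f i) (z j) = 0" if "i \<in> ?I" for i j
    proof -
      have "eval_poly (f i) (complexify (z j)) = 0"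
        using \<gamma>[of j] z[of j] that unfolding common_zeros_def by blast
      thus ?thesis by (simp add: eval_poly_of_real)
    qed
    show nz: "z j \<noteq> 0" for j using z[of j] by (simp add: affine_representative_def)
    show "z j \<notin> span {z k}" if "j \<noteq> k" for j k
    proof
      assume "z j \<in> span {z k}"
      then obtain c where c: "z j = c *\<^sub>R z k" by (auto simp: span_singleton)
      hence "\<gamma> j = \<gamma> k"
        using nz[of j] z[of j] z[of k] span_complexify_scale[of c "z k"]
        by (auto simp: affine_representative_def)
      thus False using that assms(4) by (auto simp: bij_betw_def inj_def)
    qed
  qed
  \<comment> \<open>Some point is needed as the common zero at which the gradients are
    independent.\<close>
  obtain j0 :: 'm where True by simp
  have "\<exists>u. u \<noteq> 0 \<and> relation (($) u)"
  proof (rule ex_relation)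
    \<comment> \<open>In both cases this reads \<open>11 > 10\<close>: \<open>9 + 2\<close> against
      \<open>5 choose 3\<close>, and \<open>8 + 3\<close> against \<open>5 choose 2\<close>.\<close>
    show "CARD('m) + card ?I > (d + CARD('n) - 1) choose d"
      using cases by (auto simp: numeral_eq_Suc)
  qed (use assms(3) \<gamma>[of j0] z[of j0] in \<open>auto simp: intersect_transversely_def\<close>)
  moreover have "c = (\<lambda>_. 0)" if "relation c" "c k = 0" for c k
    using cases relation_eq_0_cubics[OF _ _ _ that] relation_eq_0_quadrics[OF _ _ that] by fastforce
  ultimately obtain u where u: "\<And>j. u $ j \<noteq> 0" "eval_map z ` forms d = {y. u \<bullet> y = 0}"
    using eval_map_forms_eq_hyperplane by blast
  \<comment> \<open>The factors are nonzero, so these vectors still represent the points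
    \<open>\<gamma> j\<close>.\<close>
  define z' where "z' = (\<lambda>j. root d \<bar>u $ j\<bar> *\<^sub>R z j)"
  have d: "d > 0" using cases by auto
  have "affine_representative (complexify (z' j)) (\<gamma> j)" for j
    using z[of j] u(1)[of j] d span_complexify_scale[of "root d \<bar>u $ j\<bar>" "z j"]
    by (simp add: z'_def affine_representative_def)
  moreover have "eval_map z' ` sos_forms d =
      {x. (\<forall>j. 0 \<le> x $ j) \<and> (\<forall>k. (\<Sum>j\<in>UNIV. sqrt (x $ j)) \<ge> 2 * sqrt (x $ k))}"
    using eval_map_sos_forms[OF _ eval_map_rescaled[OF d u]] u(1) unfolding z'_def
    by (simp add: abs_sgn_eq)
  ultimately show ?thesis by blast
qed

end
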